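(* Let $\mathbf d$, $S=\{i_1<\dots<i_s\}$, $\gamma$, $\delta$, $C$, $\mathbf d_S$ and $\mathbf d_H$ be as in the context, satisfying the standing assumptions there. Then with probability $1-O(1/\sqrt{\log M})$ all of the following hold simultaneously: (a) for all $k\in[s]$ with $d(i_k)\ge \delta^{1/32}C$, $$d_S(k)=\gamma\, d(i_k)\bigl(1\pm 8\delta^{1/64}\bigr)=d_H(k)\bigl(1\pm 12\delta^{1/64}\bigr);$$ (b) for all $k\in[s]$ with $d(i_k)<\delta^{1/32}C$, $\max\{d_S(k),d_H(k)\}\le 2\gamma\delta^{1/32}C$; (c) for all integers $0\le i\le \tfrac12\gamma C$, $$|n_i(\mathbf d_S)-n_i(\mathbf d_H)|\le \frac{\gamma\, n_i(\mathbf d_H)}{C^3}+\gamma C^5 .$$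
   Context: All asymptotics are as $n\to\infty$. For each $n$, let $\mathbf d=(d(1),\dots,d(n))$ be a sequence of integers with $1\le d(1)\le\cdots\le d(n)$ and even sum; let $M=\sum_{i=1}^n d(i)$ (so $M\to\infty$), $\Delta=d(n)$, and $d(A)=\sum_{i\in A}d(i)$ for $A\subseteq[n]$. Let $G$ be a uniformly random simple graph on vertex set $[n]$ in which vertex $i$ has degree $d(i)$ for all $i$. Let $S=\{i_1,\dots,i_s\}\subseteq[n]$ with $i_1<\dots<i_s$ be a given set and $\gamma=d(S)/M$. Standing assumptions: there is a function $\delta=\delta(n)\to 0$ with $\delta^{-1}=O(\log\log M)$ such that $\Delta^2(\gamma^{-1}\log M)^{12}\le \delta\, d(S)$, and there is a constant $c>0$ with $\gamma<1-c$. Define $C=\delta^{-1/16}\gamma^{-1}\log M$. Let $d_S(k)$ denote the degree of vertex $i_k$ in the induced subgraph $G[S]$, and $\mathbf d_S=(d_S(1),\dots,d_S(s))$. For a sequence $\mathbf x$, $n_k(\mathbf x)$ is the number of entries of $\mathbf x$ equal to $k$. Definition of $\mathbf d_H$: let $Z_j\sim\mathrm{Bin}(j,\gamma)$; for $k\ge 0$ let $N(k)=\lfloor \sum_{i\in S}\Pr(Z_{d(i)}\le k)+\tfrac12\rfloor$ and $N(-1)=0$; $\mathbf d_H=(d_H(1),d_H(2),\dots)$ is the non-decreasing sequence with $n_k(\mathbf d_H)=N(k)-N(k-1)$ for all $k\ge 0$. The notation $x=y(1\pm\epsilon)$ means $|x-y|\le \epsilon y$. *)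

theory Defs
  imports "HOL-Probability.Probability" "HOL-Library.Landau_Symbols"
begin

definition vertex_pairs :: "nat \<Rightarrow> nat set set" where
  "vertex_pairs n = {e. \<exists>i j. e = {i, j} \<and> i \<noteq> j \<and> i \<in> {1..n} \<and> j \<in> {1..n}}"

definition graphs_with_degrees :: "nat \<Rightarrow> (nat \<Rightarrow> nat) \<Rightarrow> nat set set set" where
  "graphs_with_degrees n d =
     {E. E \<subseteq> vertex_pairs n \<and> (\<forall>i\<in>{1..n}. card {e\<in>E. i \<in> e} = d i)}"

definition deg_in :: "nat set set \<Rightarrow> nat set \<Rightarrow> nat \<Rightarrow> nat" where
  "deg_in E S v = card {e\<in>E. v \<in> e \<and> e \<subseteq> S}"

definition dS_list :: "nat set set \<Rightarrow> nat set \<Rightarrow> nat list" where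
  "dS_list E S = map (deg_in E S) (sorted_list_of_set S)"

definition Nfun :: "(nat \<Rightarrow> nat) \<Rightarrow> nat set \<Rightarrow> real \<Rightarrow> nat \<Rightarrow> int" where
  "Nfun d S \<gamma> k =
     \<lfloor>(\<Sum>i\<in>S. measure_pmf.prob (binomial_pmf (d i) \<gamma>) {..k}) + 1/2\<rfloor>"

definition dH_count :: "(nat \<Rightarrow> nat) \<Rightarrow> nat set \<Rightarrow> real \<Rightarrow> nat \<Rightarrow> int" where
  "dH_count d S \<gamma> k = Nfun d S \<gamma> k - (if k = 0 then 0 else Nfun d S \<gamma> (k - 1))"

text \<open>The k-th entry (1-indexed) d_H(k) of the non-decreasing sequence d_H
  with n_j(d_H) = N(j) - N(j-1): the least j with N(j) \<ge> k.\<close>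
definition dH_entry :: "(nat \<Rightarrow> nat) \<Rightarrow> nat set \<Rightarrow> real \<Rightarrow> nat \<Rightarrow> nat" where
  "dH_entry d S \<gamma> k = (LEAST j. int k \<le> Nfun d S \<gamma> j)"

end

theory Submission
  imports Defs
begin

text \<open>Fix a vertex \<open>v\<close> and compare the graphs with \<open>d\<^sub>S(v) = i\<close> to those with \<open>d\<^sub>S(v) = i + 1\<close> by
  replacing two edges \<open>vx, ab\<close> with \<open>x \<notin> S\<close>, \<open>a \<in> S\<close> by \<open>va, xb\<close>. Double counting these switchings
  shows that the ratio of the two probabilities is that of the binomial distribution with parameters
  \<open>d(v)\<close> and \<open>\<gamma>\<close>, up to a factor \<open>1 + O(\<Delta>\<^sup>2 / d(S))\<close>. Controlled ratios give both exponential
  tails, hence (a) and (b), and point probabilities with relative error \<open>O(C \<Delta>\<^sup>2 / d(S))\<close> when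
  \<open>d(v) \<le> C\<close>. The same switchings with the neighbourhood of a second vertex \<open>u\<close> held fixed give the
  joint law of \<open>d\<^sub>S(u)\<close> and \<open>d\<^sub>S(v)\<close>, and (c) follows from the second moment of the number of
  vertices with \<open>d\<^sub>S(v) = i\<close>, summed over \<open>i \<le> \<gamma> C / 2\<close>.\<close>

section \<open>Switchings\<close>

text \<open>Two obstacles shape the argument. A switching must not destroy the event conditioned on,
  so the law of d_S(v) given u is studied on families of graphs closed under all changes that
  preserve the neighbourhood of u. Adjacency of u and v is then a separate case, since it fixes one
  edge of v; it costs a factor 1/\<gamma>, paid for by its rarity. Secondly, the ratio errors
  multiply along the range of d_S(v), so they are harmless only for d(v) <= C; a vertex of larger
  degree is instead shown almost never to reach a value i <= \<gamma>C/2. The switchings lost to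
  unsuitable choices are O(\<Delta>^2) against a total of d(S) or M - d(S); the bound \<gamma> < 1 -
  c keeps the second total comparable to the first or larger. The power 12 of the hypothesis is
  spent in the last union bound: about \<gamma>C values of i, a Chebyshev factor C^6/\<gamma>^2 and
  a correlation of order C^2/(\<gamma> d(S)) multiply to C^9/(\<gamma>^2 d(S)). Nine powers cancel
  C^9, and the three spare powers of \<gamma>/log M absorb 1/\<gamma>^2 and still leave O(1/log
  M).\<close>

definition nbr :: "nat set set \<Rightarrow> nat \<Rightarrow> nat set" where
  "nbr G x = {y. {x, y} \<in> G}"

lemma nbr_sym: "y \<in> nbr G x \<longleftrightarrow> x \<in> nbr G y"
  by (simp add: nbr_def insert_commute)

lemma finite_vertex_pairs: "finite (vertex_pairs n)"
proof -
  have "vertex_pairs n \<subseteq> Pow {1..n}"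
    by (auto simp: vertex_pairs_def)
  then show ?thesis
    by (rule finite_subset) simp
qed

lemma finite_graphs_with_degrees: "finite (graphs_with_degrees n d)"
proof -
  have "graphs_with_degrees n d \<subseteq> Pow (vertex_pairs n)"
    by (auto simp: graphs_with_degrees_def)
  then show ?thesis
    by (rule finite_subset) (simp add: finite_vertex_pairs)
qed

lemma card_edges_at:
  assumes "G \<subseteq> vertex_pairs n"
  shows "card {e\<in>G. x \<in> e} = card (nbr G x)"
proof -
  have "inj_on (\<lambda>y. {x, y}) (nbr G x)"
    by (auto simp: inj_on_def doubleton_eq_iff)
  moreover have "(\<lambda>y. {x, y}) ` nbr G x = {e\<in>G. x \<in> e}"
    using assms by (fastforce simp: nbr_def vertex_pairs_def insert_commute)
  ultimately show ?thesis
    using card_image by fastforce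
qed

lemma deg_in_eq_card_nbr:
  assumes "G \<subseteq> vertex_pairs n" "v \<in> S"
  shows "deg_in G S v = card (nbr G v \<inter> S)"
proof -
  have "inj_on (\<lambda>y. {v, y}) (nbr G v \<inter> S)"
    by (auto simp: inj_on_def doubleton_eq_iff)
  moreover have "(\<lambda>y. {v, y}) ` (nbr G v \<inter> S) = {e\<in>G. v \<in> e \<and> e \<subseteq> S}"
    using assms by (fastforce simp: nbr_def vertex_pairs_def insert_commute)
  ultimately show ?thesis
    unfolding deg_in_def using card_image by fastforce
qed

lemma nbr_props:
  assumes "G \<subseteq> vertex_pairs n"
  shows "nbr G x \<subseteq> {1..n}" "finite (nbr G x)" "x \<notin> {1..n} \<Longrightarrow> nbr G x = {}"
proof -
  show 1: "nbr G x \<subseteq> {1..n}"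
    using assms by (force simp: nbr_def vertex_pairs_def doubleton_eq_iff)
  show "finite (nbr G x)"
    using 1 by (rule finite_subset) simp
  show "x \<notin> {1..n} \<Longrightarrow> nbr G x = {}"
    using assms by (force simp: nbr_def vertex_pairs_def doubleton_eq_iff)
qed

lemma graphs_with_degrees_iff:
  "G \<in> graphs_with_degrees n d \<longleftrightarrow>
     G \<subseteq> vertex_pairs n \<and> (\<forall>i\<in>{1..n}. card (nbr G i) = d i)"
  by (auto simp: graphs_with_degrees_def card_edges_at)

text \<open>Opposite edges of the 4-cycle v, x, b, a are exchanged, so interchanging the roles of
  \<open>x\<close> and \<open>a\<close> undoes the operation.\<close>

definition switch :: "nat set set \<Rightarrow> nat \<Rightarrow> nat \<Rightarrow> nat \<Rightarrow> nat \<Rightarrow> nat set set" where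
  "switch G v x a b = (G - {{v, x}, {a, b}}) \<union> {{v, a}, {x, b}}"

text \<open>The vertex \<open>u\<close> is kept untouched by these switchings; since vertices are numbered from 1,
  \<open>u = 0\<close> imposes no restriction.\<close>

definition switchings ::
    "nat set set \<Rightarrow> nat \<Rightarrow> nat \<Rightarrow> nat set \<Rightarrow> nat set \<Rightarrow> (nat \<times> nat \<times> nat) set" where
  "switchings G u v P Q =
     {(x, a, b). x \<in> nbr G v \<inter> P - {u} \<and> b \<in> nbr G a \<and> a \<in> Q \<and> a \<noteq> u \<and> b \<noteq> u
        \<and> a \<noteq> v \<and> a \<notin> nbr G v \<and> b \<noteq> x \<and> b \<notin> nbr G x}"

text \<open>The four vertices are distinct, so only their neighbourhoods change. The double count
  rests on the last two facts: the inverse switching is admissible again, with \<open>x\<close>,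
  \<open>a\<close> and also \<open>P\<close>, \<open>Q\<close> interchanged.\<close>

lemma switch_facts:
  assumes G: "G \<subseteq> vertex_pairs n" and sw: "(x, a, b) \<in> switchings G u v P Q" and "u \<noteq> v"
  shows "switch G v x a b \<subseteq> vertex_pairs n"
    and "nbr (switch G v x a b) v = insert a (nbr G v - {x})"
    and "nbr (switch G v x a b) x = insert b (nbr G x - {v})"
    and "nbr (switch G v x a b) a = insert v (nbr G a - {b})"
    and "nbr (switch G v x a b) b = insert x (nbr G b - {a})"
    and "\<And>y. y \<notin> {v, x, a, b} \<Longrightarrow> nbr (switch G v x a b) y = nbr G y"
    and "nbr (switch G v x a b) u = nbr G u"
    and "switch (switch G v x a b) v a x b = G"
    and "(a, x, b) \<in> switchings (switch G v x a b) u v Q P"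
proof -
  have e: "{v, x} \<in> G" "{a, b} \<in> G" "{v, a} \<notin> G" "{x, b} \<notin> G" "a \<noteq> v" "b \<noteq> x"
    "x \<in> P" "a \<in> Q" "x \<noteq> u" "a \<noteq> u" "b \<noteq> u"
    using sw by (auto simp: switchings_def nbr_def)
  have V: "v \<noteq> x" "a \<noteq> b" "v \<in> {1..n}" "x \<in> {1..n}" "a \<in> {1..n}" "b \<in> {1..n}"
    using e G by (force simp: vertex_pairs_def doubleton_eq_iff)+
  \<comment> \<open>\<open>b = v\<close> would turn the edge \<open>ab\<close> into the missing edge
    \<open>va\<close>, and \<open>x = a\<close> would turn the edge \<open>vx\<close> into
    it.\<close>
  have dist: "v \<noteq> b" "x \<noteq> a"
    using e by (auto simp: insert_commute)
  show "switch G v x a b \<subseteq> vertex_pairs n"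
  proof -
    have "{v, a} \<in> vertex_pairs n" "{x, b} \<in> vertex_pairs n"
      unfolding vertex_pairs_def using V e by blast+
    then show ?thesis using G by (auto simp: switch_def)
  qed
  note d = V(1,2) dist e
  show nv: "nbr (switch G v x a b) v = insert a (nbr G v - {x})"
    using d by (auto simp: nbr_def switch_def doubleton_eq_iff)
  show nx: "nbr (switch G v x a b) x = insert b (nbr G x - {v})"
    using d by (auto simp: nbr_def switch_def doubleton_eq_iff)
  show na: "nbr (switch G v x a b) a = insert v (nbr G a - {b})"
    using d by (auto simp: nbr_def switch_def doubleton_eq_iff)
  show nb: "nbr (switch G v x a b) b = insert x (nbr G b - {a})"
    using d by (auto simp: nbr_def switch_def doubleton_eq_iff)
  show no: "nbr (switch G v x a b) y = nbr G y" if "y \<notin> {v, x, a, b}" for y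
    using that d by (auto simp: nbr_def switch_def doubleton_eq_iff)
  show "nbr (switch G v x a b) u = nbr G u"
    using no e \<open>u \<noteq> v\<close> by auto
  have ne: "{v, x} \<noteq> {v, a}" "{v, x} \<noteq> {x, b}" "{a, b} \<noteq> {v, a}" "{a, b} \<noteq> {x, b}"
    using d by (auto simp: doubleton_eq_iff)
  show "switch (switch G v x a b) v a x b = G"
    using e ne unfolding switch_def by blast
  show "(a, x, b) \<in> switchings (switch G v x a b) u v Q P"
    using d nv nx na nb unfolding switchings_def by auto
qed

text \<open>Each of the four vertices loses one neighbour and gains one that it did not
  have.\<close>

lemma switch_in_graphs:
  assumes G: "G \<in> graphs_with_degrees n d" and sw: "(x, a, b) \<in> switchings G u v P Q" and "u \<noteq> v"
  shows "switch G v x a b \<in> graphs_with_degrees n d"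
proof -
  have Gv: "G \<subseteq> vertex_pairs n" and deg: "\<And>i. i \<in> {1..n} \<Longrightarrow> card (nbr G i) = d i"
    using G by (auto simp: graphs_with_degrees_iff)
  note f = switch_facts[OF Gv sw \<open>u \<noteq> v\<close>]
  have m: "x \<in> nbr G v" "b \<in> nbr G a" "a \<notin> nbr G v" "b \<notin> nbr G x"
    using sw by (auto simp: switchings_def)
  have m': "v \<in> nbr G x" "a \<in> nbr G b" "v \<notin> nbr G a" "x \<notin> nbr G b"
    using m by (metis nbr_sym)+
  have swap: "card (insert y (N - {z})) = card N" if "finite N" "z \<in> N" "y \<notin> N" for N :: "nat set" and y z
    using that by (metis DiffD1 card.insert_remove card.remove finite_Diff insert_Diff_single Diff_empty Diff_insert0 card_insert_disjoint)
  have fin: "finite (nbr G y)" for y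
    using nbr_props(2)[OF Gv] .
  have "card (nbr (switch G v x a b) i) = card (nbr G i)" for i
  proof -
    consider "i = v" | "i = x" | "i = a" | "i = b" | "i \<notin> {v, x, a, b}" by blast
    then show ?thesis
    proof cases
      case 1 then show ?thesis using f(2) swap[OF fin m(1) m(3)] by simp
    next
      case 2 then show ?thesis using f(3) swap[OF fin m'(1) m(4)] by simp
    next
      case 3 then show ?thesis using f(4) swap[OF fin m(2) m'(3)] by simp
    next
      case 4 then show ?thesis using f(5) swap[OF fin m'(2) m'(4)] by simp
    next
      case 5 then show ?thesis using f(6) by simp
    qed
  qed
  then show ?thesis
    using f(1) deg by (auto simp: graphs_with_degrees_iff)
qed

lemma sum_degrees_eq_card:
  assumes "G \<in> graphs_with_degrees n d"
  shows "card {(a, b). a \<in> Q \<and> b \<in> nbr G a} = (\<Sum>a\<in>Q \<inter> {1..n}. d a)"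
    and "finite {(a, b). a \<in> Q \<and> b \<in> nbr G a}"
proof -
  have G: "G \<subseteq> vertex_pairs n" and deg: "\<And>i. i \<in> {1..n} \<Longrightarrow> card (nbr G i) = d i"
    using assms by (auto simp: graphs_with_degrees_iff)
  have eq: "{(a, b). a \<in> Q \<and> b \<in> nbr G a} = (SIGMA a : Q \<inter> {1..n}. nbr G a)"
    using nbr_props(3)[OF G] by fastforce
  show "finite {(a, b). a \<in> Q \<and> b \<in> nbr G a}"
    unfolding eq using nbr_props(2)[OF G] by auto
  show "card {(a, b). a \<in> Q \<and> b \<in> nbr G a} = (\<Sum>a\<in>Q \<inter> {1..n}. d a)"
    unfolding eq using nbr_props(2)[OF G] deg by (simp add: card_SigmaI)
qed

text \<open>Choosing \<open>x\<close> and an oriented edge \<open>(a, b)\<close> with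
  \<open>a\<close> in \<open>Q\<close> freely gives the upper bound. For the lower bound, an
  excluded edge starts at \<open>u\<close>, \<open>v\<close> or a neighbour of \<open>v\<close>, or
  ends at \<open>u\<close>, \<open>x\<close> or a neighbour of \<open>x\<close>; each alternative
  covers at most \<open>(\<Delta> + 2) * \<Delta>\<close> oriented edges.\<close>

lemma card_switchings:
  fixes u v \<Delta> :: nat and P Q :: "nat set"
  assumes G: "G \<in> graphs_with_degrees n d" and \<Delta>: "\<And>i. i \<in> {1..n} \<Longrightarrow> d i \<le> \<Delta>"
  defines "m \<equiv> card (nbr G v \<inter> P - {u})" and "D \<equiv> (\<Sum>a\<in>Q \<inter> {1..n}. d a)"
  shows "finite (switchings G u v P Q)"
    and "card (switchings G u v P Q) \<le> m * D"
    and "real m * (real D - 2 * real \<Delta> * (real \<Delta> + 2)) \<le> real (card (switchings G u v P Q))"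
proof -
  have Gv: "G \<subseteq> vertex_pairs n" and deg: "\<And>i. i \<in> {1..n} \<Longrightarrow> card (nbr G i) = d i"
    using G by (auto simp: graphs_with_degrees_iff)
  have fin: "finite (nbr G y)" for y
    using nbr_props(2)[OF Gv] .
  have degle: "card (nbr G y) \<le> \<Delta>" for y
    using deg[of y] \<Delta>[of y] nbr_props(3)[OF Gv, of y] by (cases "y \<in> {1..n}") auto
  define X where "X = nbr G v \<inter> P - {u}"
  have finX: "finite X" using fin by (auto simp: X_def)
  define E where "E = {(a, b). a \<in> Q \<and> b \<in> nbr G a}"
  have E: "finite E" "card E = D"
    using sum_degrees_eq_card[OF G] by (auto simp: E_def D_def)
  define ok where "ok = (\<lambda>x. {(a, b) \<in> E. a \<noteq> u \<and> b \<noteq> u \<and> a \<noteq> v \<and> a \<notin> nbr G v \<and> b \<noteq> x \<and> b \<notin> nbr G x})"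
  have eq: "switchings G u v P Q = (SIGMA x : X. ok x)"
    by (auto simp: switchings_def X_def ok_def E_def)
  have okE: "ok x \<subseteq> E" for x
    by (auto simp: ok_def)
  have finok: "finite (ok x)" for x
    using finite_subset[OF okE E(1)] .
  show "finite (switchings G u v P Q)"
    unfolding eq using finX finok by auto
  have c: "card (switchings G u v P Q) = (\<Sum>x\<in>X. card (ok x))"
    unfolding eq using finX finok by (simp add: card_SigmaI)
  have "card (ok x) \<le> D" for x
    using card_mono[OF E(1) okE] E(2) by simp
  then have "(\<Sum>x\<in>X. card (ok x)) \<le> card X * D"
    using sum_bounded_above[of X "\<lambda>x. card (ok x)" D] by simp
  then show "card (switchings G u v P Q) \<le> m * D"
    by (simp add: c m_def X_def)
  have star: "card (SIGMA y : insert w (insert u (nbr G w)). nbr G y) \<le> (\<Delta> + 2) * \<Delta>" for w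
  proof -
    have "card (SIGMA y : insert w (insert u (nbr G w)). nbr G y)
            = (\<Sum>y\<in>insert w (insert u (nbr G w)). card (nbr G y))"
      using fin by (simp add: card_SigmaI)
    also have "\<dots> \<le> card (insert w (insert u (nbr G w))) * \<Delta>"
      using sum_bounded_above[of "insert w (insert u (nbr G w))" "\<lambda>y. card (nbr G y)" \<Delta>] degle by simp
    also have "card (insert w (insert u (nbr G w))) \<le> \<Delta> + 2"
      using degle[of w] fin[of w] by (auto simp: card_insert_if)
    finally show ?thesis by simp
  qed
  have ge: "real D - 2 * real \<Delta> * (real \<Delta> + 2) \<le> real (card (ok x))" for x
  proof -
    let ?B1 = "SIGMA y : insert v (insert u (nbr G v)). nbr G y"
    \<comment> \<open>Edges excluded on account of \<open>b\<close> are enumerated starting from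
      \<open>b\<close>, hence the reversed pairs.\<close>
    let ?B2 = "prod.swap ` (SIGMA y : insert x (insert u (nbr G x)). nbr G y)"
    have "E \<subseteq> ok x \<union> (?B1 \<union> ?B2)"
    proof
      fix p assume p: "p \<in> E"
      obtain a b where ab: "p = (a, b)" by force
      show "p \<in> ok x \<union> (?B1 \<union> ?B2)"
      proof (cases "a = u \<or> a = v \<or> a \<in> nbr G v")
        case True then show ?thesis using p ab by (auto simp: E_def)
      next
        case F: False
        show ?thesis
        proof (cases "b = u \<or> b = x \<or> b \<in> nbr G x")
          case True
          then have "(b, a) \<in> (SIGMA y : insert x (insert u (nbr G x)). nbr G y)"
            using p ab nbr_sym[of b G a] by (auto simp: E_def)
          then have "p \<in> ?B2" using ab by force
          then show ?thesis by blast
        next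
          case False then show ?thesis using F p ab by (auto simp: ok_def)
        qed
      qed
    qed
    then have "card E \<le> card (ok x \<union> (?B1 \<union> ?B2))"
      using fin finok by (intro card_mono) auto
    also have "\<dots> \<le> card (ok x) + (card ?B1 + card ?B2)"
      by (meson add_mono card_Un_le le_trans order_refl)
    also have "card ?B2 \<le> card (SIGMA y : insert x (insert u (nbr G x)). nbr G y)"
      by (intro card_image_le finite_SigmaI) (auto simp: fin)
    finally have "D \<le> card (ok x) + ((\<Delta> + 2) * \<Delta> + (\<Delta> + 2) * \<Delta>)"
      using star[of v] star[of x] E(2) by linarith
    then have "real D \<le> real (card (ok x) + ((\<Delta> + 2) * \<Delta> + (\<Delta> + 2) * \<Delta>))"
      using of_nat_le_iff by blast
    then show ?thesis by (simp add: algebra_simps)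
  qed
  have "real (card X) * (real D - 2 * real \<Delta> * (real \<Delta> + 2)) \<le> (\<Sum>x\<in>X. real (card (ok x)))"
    using sum_bounded_below[of X "real D - 2 * real \<Delta> * (real \<Delta> + 2)" "\<lambda>x. real (card (ok x))"] ge
    by simp
  then show "real m * (real D - 2 * real \<Delta> * (real \<Delta> + 2)) \<le> real (card (switchings G u v P Q))"
    by (simp add: c m_def X_def)
qed

text \<open>Pairs (graph, switching) are counted from both ends. \<open>B\<close> only has to
  contain the results and \<open>mB\<close> only has to be an upper bound, so the inequality yields
  the ratio bounds in both directions and also the bound on adjacent pairs in
  \<open>card_adjacent_le\<close>.\<close>

lemma switching_inequality:
  assumes \<Delta>: "\<And>i. i \<in> {1..n} \<Longrightarrow> d i \<le> \<Delta>" and "u \<noteq> v"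
    and A: "A \<subseteq> graphs_with_degrees n d" and B: "B \<subseteq> graphs_with_degrees n d"
    and step: "\<And>G x a b. G \<in> A \<Longrightarrow> (x, a, b) \<in> switchings G u v P Q \<Longrightarrow> switch G v x a b \<in> B"
    and mA: "\<And>G. G \<in> A \<Longrightarrow> card (nbr G v \<inter> P - {u}) = mA"
    and mB: "\<And>G. G \<in> B \<Longrightarrow> card (nbr G v \<inter> Q - {u}) \<le> mB"
  shows "real mA * (real (\<Sum>a\<in>Q \<inter> {1..n}. d a) - 2 * real \<Delta> * (real \<Delta> + 2)) * real (card A)
           \<le> real mB * real (\<Sum>a\<in>P \<inter> {1..n}. d a) * real (card B)"
proof -
  have finA: "finite A" and finB: "finite B"
    using A B finite_graphs_with_degrees finite_subset by blast+
  define TA where "TA = (SIGMA G : A. switchings G u v P Q)"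
  define TB where "TB = (SIGMA G : B. switchings G u v Q P)"
  \<comment> \<open>One formula describes the map and its inverse, so \<open>f (f p) = p\<close>
    gives injectivity at once.\<close>
  define f where "f = (\<lambda>(G, x, a, b). (switch G v x a b, a, x, b))"
  have fin: "finite (switchings G u v P' Q')" if "G \<in> A \<union> B" for G P' Q'
    using card_switchings(1)[of G n d \<Delta>] that A B \<Delta> by blast
  have inv: "f (f p) = p \<and> f p \<in> TB" if "p \<in> TA" for p
  proof -
    obtain G x a b where p: "p = (G, x, a, b)" by (cases p)
    have G: "G \<in> A" and sw: "(x, a, b) \<in> switchings G u v P Q"
      using that p by (auto simp: TA_def)
    have Gv: "G \<subseteq> vertex_pairs n"
      using subsetD[OF A G] by (simp add: graphs_with_degrees_iff)
    show ?thesis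
      using switch_facts(8,9)[OF Gv sw \<open>u \<noteq> v\<close>] step[OF G sw] by (auto simp: p f_def TB_def)
  qed
  have "inj_on f TA"
    by (metis inj_onI inv)
  moreover have "f ` TA \<subseteq> TB"
    using inv by blast
  moreover have "finite TB"
    using finB fin by (auto simp: TB_def)
  ultimately have le: "card TA \<le> card TB"
    using card_inj_on_le by blast
  have "real mA * (real (\<Sum>a\<in>Q \<inter> {1..n}. d a) - 2 * real \<Delta> * (real \<Delta> + 2)) * real (card A)
      = (\<Sum>G\<in>A. real mA * (real (\<Sum>a\<in>Q \<inter> {1..n}. d a) - 2 * real \<Delta> * (real \<Delta> + 2)))"
    by simp
  also have "\<dots> \<le> (\<Sum>G\<in>A. real (card (switchings G u v P Q)))"
    using card_switchings(3)[of _ n d \<Delta> v P u Q] A \<Delta> mA by (intro sum_mono) (metis subsetD)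
  also have "\<dots> = real (card TA)"
    using finA fin by (simp add: TA_def card_SigmaI)
  also have "\<dots> \<le> real (card TB)"
    using le by simp
  also have "\<dots> = (\<Sum>G\<in>B. real (card (switchings G u v Q P)))"
    using finB fin by (simp add: TB_def card_SigmaI)
  also have "\<dots> \<le> (\<Sum>G\<in>B. real mB * real (\<Sum>a\<in>P \<inter> {1..n}. d a))"
  proof (intro sum_mono)
    fix G assume G: "G \<in> B"
    have "card (switchings G u v Q P) \<le> card (nbr G v \<inter> Q - {u}) * (\<Sum>a\<in>P \<inter> {1..n}. d a)"
      using card_switchings(2)[of G n d \<Delta>] G B \<Delta> by blast
    also have "\<dots> \<le> mB * (\<Sum>a\<in>P \<inter> {1..n}. d a)"
      using mB[OF G] by simp
    finally show "real (card (switchings G u v Q P)) \<le> real mB * real (\<Sum>a\<in>P \<inter> {1..n}. d a)"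
      by (metis of_nat_le_iff of_nat_mult)
  qed
  finally show ?thesis
    by (simp add: mult.commute)
qed

section \<open>Distributions with nearly binomial ratios\<close>

text \<open>For \<open>\<epsilon> = 0\<close> the ratio conditions are the recurrence of the binomial distribution with
  parameters \<open>D\<close> and \<open>g\<close>; a switching argument yields them up to a factor \<open>1 - \<epsilon>\<close>.\<close>

definition near_binomial :: "real \<Rightarrow> nat \<Rightarrow> real \<Rightarrow> (nat \<Rightarrow> real) \<Rightarrow> bool" where
  "near_binomial \<epsilon> D g q \<longleftrightarrow>
     (\<forall>i. 0 \<le> q i) \<and> (\<forall>i>D. q i = 0) \<and> (\<Sum>i\<le>D. q i) = 1 \<and>
     (\<forall>i<D. (1 - \<epsilon>) * ((real D - real i) * g * q i) \<le> (real i + 1) * (1 - g) * q (Suc i) \<and>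
            (1 - \<epsilon>) * ((real i + 1) * (1 - g) * q (Suc i)) \<le> (real D - real i) * g * q i)"

lemma near_binomialD:
  assumes "near_binomial \<epsilon> D g q"
  shows "0 \<le> q i" "i > D \<Longrightarrow> q i = 0" "(\<Sum>i\<le>D. q i) = 1" "q i \<le> 1"
    "i < D \<Longrightarrow> (1 - \<epsilon>) * ((real D - real i) * g * q i) \<le> (real i + 1) * (1 - g) * q (Suc i)"
    "i < D \<Longrightarrow> (1 - \<epsilon>) * ((real i + 1) * (1 - g) * q (Suc i)) \<le> (real D - real i) * g * q i"
proof -
  note a = assms[unfolded near_binomial_def]
  show "0 \<le> q i" "i > D \<Longrightarrow> q i = 0" "(\<Sum>i\<le>D. q i) = 1"
    "i < D \<Longrightarrow> (1 - \<epsilon>) * ((real D - real i) * g * q i) \<le> (real i + 1) * (1 - g) * q (Suc i)"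
    "i < D \<Longrightarrow> (1 - \<epsilon>) * ((real i + 1) * (1 - g) * q (Suc i)) \<le> (real D - real i) * g * q i"
    using a by auto
  show "q i \<le> 1"
  proof (cases "i \<le> D")
    case True
    then have "q i \<le> (\<Sum>i\<le>D. q i)"
      using a by (intro member_le_sum) auto
    then show ?thesis using a by simp
  qed (use a in auto)
qed

text \<open>The absorption identities for binomial coefficients make the two sides of the ratio
  conditions equal, and a factor \<open>1 - \<epsilon>\<close> only weakens that. The case
  \<open>\<epsilon> = 0\<close> lets the tail bounds below apply to the binomial distribution
  itself.\<close>

lemma near_binomial_pmf:
  assumes g: "0 < g" "g < 1" and "0 \<le> \<epsilon>"
  shows "near_binomial \<epsilon> D g (pmf (binomial_pmf D g))"
proof -
  let ?p = "pmf (binomial_pmf D g)"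
  have p: "?p k = real (D choose k) * g ^ k * (1 - g) ^ (D - k)" for k
    using g by simp
  have eq: "(real D - real i) * g * ?p i = (real i + 1) * (1 - g) * ?p (Suc i)" if "i < D" for i
  proof -
    have "Suc i * (D choose Suc i) = (D - i) * (D choose i)"
      unfolding binomial_absorb_comp binomial_absorption ..
    then have "real (Suc i * (D choose Suc i)) = real ((D - i) * (D choose i))"
      by (rule arg_cong)
    then have c: "(real i + 1) * real (D choose Suc i) = (real D - real i) * real (D choose i)"
      using that by (simp only: of_nat_mult of_nat_diff[OF less_imp_le[OF that]] of_nat_Suc add.commute)
    have Di: "D - i = Suc (D - Suc i)" using that by simp
    have "(real D - real i) * g * ?p i = ((real D - real i) * real (D choose i)) * (g ^ Suc i * (1 - g) ^ Suc (D - Suc i))"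
      unfolding p Di by simp
    also have "\<dots> = (real i + 1) * (1 - g) * ?p (Suc i)"
      unfolding p c[symmetric] by simp
    finally show ?thesis .
  qed
  have "(\<Sum>i\<le>D. ?p i) = 1"
    using g by (intro sum_pmf_eq_1) (auto simp: set_pmf_binomial_eq)
  moreover have le: "(1 - \<epsilon>) * x \<le> x" if "0 \<le> x" for x :: real
    using that \<open>0 \<le> \<epsilon>\<close> by (simp add: algebra_simps)
  moreover have "0 \<le> (real i + 1) * (1 - g) * ?p (Suc i)" for i
    using g by (intro mult_nonneg_nonneg) auto
  moreover have "?p i = 0" if "i > D" for i
    using that by (simp add: p)
  ultimately show ?thesis
    unfolding near_binomial_def using pmf_nonneg[of "binomial_pmf D g"] by (metis (no_types, lifting) eq)
qed

text \<open>At most \<open>D\<close> steps lead from \<open>i\<close> to \<open>j\<close>, and each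
  costs a factor \<open>r\<close>.\<close>

lemma ratio_chain:
  fixes w :: "nat \<Rightarrow> real"
  assumes r: "0 \<le> r" "r \<le> 1" and nn: "\<And>i. i \<le> D \<Longrightarrow> 0 \<le> w i"
    and up: "\<And>i. i < D \<Longrightarrow> r * w i \<le> w (Suc i)" and down: "\<And>i. i < D \<Longrightarrow> r * w (Suc i) \<le> w i"
    and "i \<le> D" "j \<le> D"
  shows "r ^ D * w i \<le> w j"
proof -
  have 1: "r ^ k * w i \<le> w (i + k)" if "i + k \<le> D" for i k
    using that
  proof (induction k)
    case (Suc k)
    then have "r * (r ^ k * w i) \<le> r * w (i + k)"
      using r by (intro mult_left_mono) auto
    then show ?case using up[of "i + k"] Suc.prems by simp
  qed simp
  have 2: "r ^ k * w (i + k) \<le> w i" if "i + k \<le> D" for i k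
    using that
  proof (induction k)
    case (Suc k)
    have "r ^ k * (r * w (Suc (i + k))) \<le> r ^ k * w (i + k)"
      using r down[of "i + k"] Suc.prems by (intro mult_left_mono) auto
    then show ?case using Suc by (simp add: mult.assoc mult.left_commute)
  qed simp
  have 3: "r ^ D * w i \<le> r ^ k * w i" if "k \<le> D" for k
    using r nn \<open>i \<le> D\<close> that by (intro mult_right_mono power_decreasing) auto
  show ?thesis
  proof (cases "i \<le> j")
    case True
    then show ?thesis using 1[of i "j - i"] 3[of "j - i"] \<open>j \<le> D\<close> by force
  next
    case False
    then show ?thesis using 2[of j "i - j"] 3[of "i - j"] \<open>i \<le> D\<close> by force
  qed
qed

text \<open>The quotient \<open>w = q / p\<close> changes by a factor of at least
  \<open>1 - \<epsilon>\<close> and at most its inverse per step, and its average under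
  \<open>p\<close> is 1 because both distributions have total mass 1. Comparing \<open>w i\<close>
  with this average gives both bounds.\<close>

lemma near_binomial_pointwise:
  assumes q: "near_binomial \<epsilon> D g q" and g: "0 < g" "g < 1" and \<epsilon>: "0 \<le> \<epsilon>" "\<epsilon> \<le> 1"
  shows "(1 - \<epsilon>) ^ D * q i \<le> pmf (binomial_pmf D g) i"
    and "(1 - \<epsilon>) ^ D * pmf (binomial_pmf D g) i \<le> q i"
proof -
  define p where "p = pmf (binomial_pmf D g)"
  have p: "near_binomial 0 D g p"
    unfolding p_def using near_binomial_pmf g by simp
  have ppos: "0 < p i" if "i \<le> D" for i
    using g that by (simp add: p_def)
  have peq: "(real i + 1) * (1 - g) * p (Suc i) = (real D - real i) * g * p i" if "i < D" for i
    using near_binomialD(5,6)[OF p that] by simp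
  define w where "w = (\<lambda>i. q i / p i)"
  have w: "q i = w i * p i" if "i \<le> D" for i
    using ppos[OF that] by (simp add: w_def)
  have *: "r ^ D * w i \<le> w j" if "i \<le> D" "j \<le> D" "r = 1 - \<epsilon>" for i j r
  proof (rule ratio_chain[OF _ _ _ _ _ that(1,2)])
    show "0 \<le> r" "r \<le> 1" using \<epsilon> that by auto
    show "0 \<le> w i" if "i \<le> D" for i
      using near_binomialD(1)[OF q] near_binomialD(1)[OF p] by (simp add: w_def)
    fix i assume i: "i < D"
    define X where "X = (real i + 1) * (1 - g) * p (Suc i)"
    have X: "X > 0" using g ppos[of "Suc i"] i by (auto simp: X_def)
    have "(real D - real i) * g * q i = X * w i"
      unfolding X_def peq[OF i] using w[of i] i by simp
    moreover have "(real i + 1) * (1 - g) * q (Suc i) = X * w (Suc i)"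
      using w[of "Suc i"] i by (simp add: X_def algebra_simps)
    ultimately have "X * (r * w i) \<le> X * w (Suc i)" "X * (r * w (Suc i)) \<le> X * w i"
      using near_binomialD(5,6)[OF q i] that by (simp_all add: mult.left_commute)
    then show "r * w i \<le> w (Suc i)" "r * w (Suc i) \<le> w i"
      using X by auto
  qed
  have "(1 - \<epsilon>) ^ D * q i \<le> p i \<and> (1 - \<epsilon>) ^ D * p i \<le> q i" if "i \<le> D"
  proof
    have "(1 - \<epsilon>) ^ D * w i = (\<Sum>j\<le>D. ((1 - \<epsilon>) ^ D * w i) * p j)"
      using near_binomialD(3)[OF p] by (simp add: sum_distrib_left[symmetric])
    also have "\<dots> \<le> (\<Sum>j\<le>D. w j * p j)"
      using *[OF that] ppos by (intro sum_mono mult_right_mono) (auto intro: less_imp_le)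
    also have "\<dots> = 1"
      using w near_binomialD(3)[OF q] by simp
    finally have "(1 - \<epsilon>) ^ D * w i * p i \<le> 1 * p i"
      using ppos[OF that] by (intro mult_right_mono) auto
    then show "(1 - \<epsilon>) ^ D * q i \<le> p i"
      using w[OF that] by (simp add: mult.assoc)
    have "(1 - \<epsilon>) ^ D = (\<Sum>j\<le>D. (1 - \<epsilon>) ^ D * (w j * p j))"
      using w near_binomialD(3)[OF q] by (simp add: sum_distrib_left[symmetric])
    also have "\<dots> = (\<Sum>j\<le>D. ((1 - \<epsilon>) ^ D * w j) * p j)"
      by (simp add: mult.assoc)
    also have "\<dots> \<le> (\<Sum>j\<le>D. w i * p j)"
      using *[OF _ that] ppos by (intro sum_mono mult_right_mono) (auto intro: less_imp_le)
    also have "\<dots> = w i"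
      using near_binomialD(3)[OF p] by (simp add: sum_distrib_left[symmetric])
    finally show "(1 - \<epsilon>) ^ D * p i \<le> q i"
      using w[OF that] ppos[OF that] by (simp add: mult_right_mono)
  qed
  moreover have "q i = 0" "p i = 0" if "\<not> i \<le> D"
    using near_binomialD(2)[OF q, of i] near_binomialD(2)[OF p, of i] that by auto
  ultimately show "(1 - \<epsilon>) ^ D * q i \<le> pmf (binomial_pmf D g) i"
    "(1 - \<epsilon>) ^ D * pmf (binomial_pmf D g) i \<le> q i"
    unfolding p_def by (cases "i \<le> D"; simp)+
qed

text \<open>Beyond \<open>(1 + \<eta>) * g * R\<close> every step shrinks \<open>q\<close> by at
  least \<open>exp (- (3/4 * \<eta>))\<close>; up to one step past that point the claimed bound is
  at least 1. Allowing \<open>R\<close> above \<open>D\<close> gives vertices of small degree a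
  common threshold, as part (b) demands.\<close>

lemma near_binomial_upper:
  assumes q: "near_binomial \<epsilon> D g q" and g: "0 < g" "g < 1"
    and \<eta>: "0 < \<eta>" "\<eta> \<le> 1/4" and \<epsilon>: "0 \<le> \<epsilon>" "\<epsilon> \<le> \<eta> / 16" and R: "real D \<le> R"
  shows "q i \<le> exp (- (3/4 * \<eta>) * (real i - (1 + \<eta>) * g * R - 1))"
proof (induction i)
  case 0
  have "0 \<le> (1 + \<eta>) * g * R"
    using \<eta> g R by simp
  then have "0 \<le> - (3/4 * \<eta>) * (real 0 - (1 + \<eta>) * g * R - 1)"
    using \<eta> by (intro mult_nonpos_nonpos) auto
  then have "1 \<le> exp (- (3/4 * \<eta>) * (real 0 - (1 + \<eta>) * g * R - 1))"
    by (simp only: one_le_exp_iff)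
  then show ?case using near_binomialD(4)[OF q, of 0] by linarith
next
  case (Suc i)
  let ?A = "(1 + \<eta>) * g * R"
  consider "i \<ge> D" | "i < D" "real i < ?A" | "i < D" "?A \<le> real i" by linarith
  then show ?case
  proof cases
    case 1
    then show ?thesis using near_binomialD(2)[OF q, of "Suc i"] by simp
  next
    case 2
    then have "0 \<le> - (3/4 * \<eta>) * (real (Suc i) - ?A - 1)"
      using \<eta> by (intro mult_nonpos_nonpos) auto
    then have "1 \<le> exp (- (3/4 * \<eta>) * (real (Suc i) - ?A - 1))"
      by (simp only: one_le_exp_iff)
    then show ?thesis using near_binomialD(4)[OF q, of "Suc i"] by linarith
  next
    case 3
    have Rpos: "R > 0" using 3 R by linarith
    have q0: "0 \<le> q i" "0 \<le> q (Suc i)" using near_binomialD(1)[OF q] by auto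
    have e1: "1 - \<epsilon> \<ge> 0" using \<epsilon> \<eta> by simp
    define Z where "Z = R * g * (1 - g)"
    have Z: "Z > 0" using Rpos g by (simp add: Z_def)
    \<comment> \<open>Past the threshold \<open>D - i\<close> is at most \<open>R - R * g\<close>,
      so \<open>R * g * (1 - g)\<close> can be cancelled and the ratio of \<open>q (Suc i)\<close>
      to \<open>q i\<close> is at most \<open>1 / ((1 - \<epsilon>) * (1 + \<eta>))\<close>.\<close>
    have "(1 - \<epsilon>) * (?A * (1 - g) * q (Suc i)) \<le> (1 - \<epsilon>) * ((real i + 1) * (1 - g) * q (Suc i))"
      using 3 e1 g q0 by (intro mult_left_mono mult_right_mono) auto
    also have "\<dots> \<le> (real D - real i) * g * q i"
      using near_binomialD(6)[OF q 3(1)] .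
    also have "\<dots> \<le> (R - R * g) * g * q i"
    proof (intro mult_right_mono)
      have "0 \<le> \<eta> * g * R" using \<eta> g Rpos by simp
      then have "R * g \<le> ?A" by (simp add: algebra_simps)
      then show "real D - real i \<le> R - R * g" using 3 R by linarith
    qed (use g q0 in auto)
    finally have "Z * ((1 - \<epsilon>) * (1 + \<eta>) * q (Suc i)) \<le> Z * q i"
      by (simp add: Z_def algebra_simps)
    then have s: "(1 - \<epsilon>) * (1 + \<eta>) * q (Suc i) \<le> q i"
      using Z by auto
    \<comment> \<open>The rate 3/4 leaves room for the loss
      \<open>\<epsilon> \<le> \<eta> / 16\<close>: for \<open>\<eta> \<le> 1/4\<close> the left side
      is at most \<open>1 + 57/64 * \<eta>\<close> and the right side at least
      \<open>1 + 59/64 * \<eta>\<close>.\<close>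
    have "exp (3/4 * \<eta>) \<le> 1 + 3/4 * \<eta> + (3/4 * \<eta>)\<^sup>2"
      using \<eta> by (intro exp_bound) auto
    also have "\<dots> \<le> 1 + 3/4 * \<eta> + 9/64 * \<eta>"
      using \<eta> by (simp add: power2_eq_square)
    also have "\<dots> \<le> (1 - \<eta>/16) * (1 + \<eta>)"
    proof -
      have "\<eta> * \<eta> \<le> 1/4 * \<eta>" using \<eta> by (intro mult_right_mono) auto
      moreover have "(1 - \<eta>/16) * (1 + \<eta>) = 1 + 15/16 * \<eta> - \<eta> * \<eta> / 16" by (simp add: field_simps)
      ultimately show ?thesis using \<eta> by linarith
    qed
    also have "\<dots> \<le> (1 - \<epsilon>) * (1 + \<eta>)"
      using \<epsilon> \<eta> by (intro mult_right_mono) auto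
    finally have "exp (3/4 * \<eta>) \<le> (1 - \<epsilon>) * (1 + \<eta>)" .
    from mult_right_mono[OF this q0(2)] have "exp (3/4 * \<eta>) * q (Suc i) \<le> q i"
      using s by linarith
    also note Suc.IH
    finally have "exp (- (3/4 * \<eta>)) * (exp (3/4 * \<eta>) * q (Suc i))
        \<le> exp (- (3/4 * \<eta>)) * exp (- (3/4 * \<eta>) * (real i - ?A - 1))"
      by (intro mult_left_mono) auto
    moreover have "exp (- (3/4 * \<eta>)) * (exp (3/4 * \<eta>) * q (Suc i)) = q (Suc i)"
      by (simp add: mult.assoc[symmetric] exp_add[symmetric])
    moreover have "- (3/4 * \<eta>) + - (3/4 * \<eta>) * (real i - ?A - 1) = - (3/4 * \<eta>) * (real (Suc i) - ?A - 1)"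
      by (simp add: field_simps)
    ultimately show ?thesis
      by (simp only: exp_add[symmetric])
  qed
qed

text \<open>Mirror image of the upper tail, by downward induction from \<open>D\<close>: below
  \<open>(1 - \<eta>) * g * D\<close> each step down shrinks \<open>q\<close> by a factor
  \<open>(1 - \<eta>) / (1 - \<epsilon>)\<close>, which is at most
  \<open>exp (- (3/4 * \<eta>))\<close>. At \<open>D\<close> itself the claimed bound is at least
  1.\<close>

lemma near_binomial_lower:
  assumes q: "near_binomial \<epsilon> D g q" and g: "0 < g" "g < 1"
    and \<eta>: "0 < \<eta>" "\<eta> \<le> 1/4" and \<epsilon>: "0 \<le> \<epsilon>" "\<epsilon> \<le> \<eta> / 16" and "i \<le> D"
  shows "q i \<le> exp (- (3/4 * \<eta>) * ((1 - \<eta>) * g * real D - 1 - real i))"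
  using \<open>i \<le> D\<close>
proof (induction i rule: inc_induct)
  case base
  have "(1 - \<eta>) * g * real D \<le> 1 * 1 * real D"
    using \<eta> g by (intro mult_mono) auto
  then have "0 \<le> - (3/4 * \<eta>) * ((1 - \<eta>) * g * real D - 1 - real D)"
    using \<eta> by (intro mult_nonpos_nonpos) auto
  then have "1 \<le> exp (- (3/4 * \<eta>) * ((1 - \<eta>) * g * real D - 1 - real D))"
    by (simp only: one_le_exp_iff)
  then show ?case using near_binomialD(4)[OF q, of D] by linarith
next
  case (step i)
  let ?A = "(1 - \<eta>) * g * real D"
  show ?case
  proof (cases "?A < real i + 1")
    case True
    then have "0 \<le> - (3/4 * \<eta>) * (?A - 1 - real i)"
      using \<eta> by (intro mult_nonpos_nonpos) auto
    then have "1 \<le> exp (- (3/4 * \<eta>) * (?A - 1 - real i))"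
      by (simp only: one_le_exp_iff)
    then show ?thesis using near_binomialD(4)[OF q, of i] by linarith
  next
    case F: False
    have i: "i < D" using step by simp
    have q0: "0 \<le> q i" "0 \<le> q (Suc i)" using near_binomialD(1)[OF q] by auto
    have e1: "1 - \<epsilon> \<ge> 0" using \<epsilon> \<eta> by simp
    define Z where "Z = real D * g * (1 - g)"
    have Z: "Z > 0" using i g by (simp add: Z_def)
    have "(1 - \<epsilon>) * ((real D - real D * g) * g * q i) \<le> (1 - \<epsilon>) * ((real D - real i) * g * q i)"
    proof (intro mult_left_mono mult_right_mono)
      have "0 \<le> \<eta> * g * real D" using \<eta> g by simp
      then have "?A \<le> real D * g" by (simp add: algebra_simps)
      then show "real D - real D * g \<le> real D - real i" using F by linarith
    qed (use e1 g q0 in auto)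
    also have "\<dots> \<le> (real i + 1) * (1 - g) * q (Suc i)"
      using near_binomialD(5)[OF q i] .
    also have "\<dots> \<le> ?A * (1 - g) * q (Suc i)"
      using F g q0 by (intro mult_right_mono) auto
    finally have "Z * ((1 - \<epsilon>) * q i) \<le> Z * ((1 - \<eta>) * q (Suc i))"
      by (simp add: Z_def algebra_simps)
    then have s: "(1 - \<epsilon>) * q i \<le> (1 - \<eta>) * q (Suc i)"
      using Z by auto
    have "1 - \<eta> \<le> (1 - \<eta>/16) * (1 - 3/4 * \<eta>)"
      using \<eta> by (simp add: algebra_simps)
    also have "\<dots> \<le> (1 - \<epsilon>) * exp (- (3/4 * \<eta>))"
    proof (intro mult_mono)
      show "1 - 3/4 * \<eta> \<le> exp (- (3/4 * \<eta>))"
        using exp_ge_add_one_self[of "- (3/4 * \<eta>)"] by simp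
    qed (use \<epsilon> \<eta> in auto)
    finally have "1 - \<eta> \<le> (1 - \<epsilon>) * exp (- (3/4 * \<eta>))" .
    from mult_right_mono[OF this q0(2)]
    have "(1 - \<epsilon>) * q i \<le> (1 - \<epsilon>) * (exp (- (3/4 * \<eta>)) * q (Suc i))"
      using s by (simp only: mult.assoc)
    then have "q i \<le> exp (- (3/4 * \<eta>)) * q (Suc i)"
      using \<epsilon> \<eta> by simp
    also have "\<dots> \<le> exp (- (3/4 * \<eta>)) * exp (- (3/4 * \<eta>) * (?A - 1 - real (Suc i)))"
      using step.IH by (intro mult_left_mono) auto
    also have "\<dots> = exp (- (3/4 * \<eta>) * (?A - 1 - real i))"
    proof -
      have "- (3/4 * \<eta>) + - (3/4 * \<eta>) * (?A - 1 - real (Suc i)) = - (3/4 * \<eta>) * (?A - 1 - real i)"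
        by (simp add: field_simps)
      then show ?thesis by (simp only: exp_add[symmetric])
    qed
    finally show ?thesis .
  qed
qed

text \<open>Doubling \<open>\<eta>\<close> in the threshold puts every point of the tail at distance
  at least \<open>\<eta> * g * R\<close> from where the decay begins. With \<open>L = ln M\<close>
  the result is M^(-3/2), small enough for a union bound over at most M vertices.\<close>

lemma near_binomial_tails:
  assumes q: "near_binomial \<epsilon> D g q" and g: "0 < g" "g < 1"
    and \<eta>: "0 < \<eta>" "\<eta> \<le> 1/4" and \<epsilon>: "0 \<le> \<epsilon>" "\<epsilon> \<le> \<eta> / 16"
    and L: "8 \<le> L" and D: "real D + 1 \<le> exp (L/2 + 1)"
  shows "real D \<le> R \<Longrightarrow> 3 * L \<le> \<eta>\<^sup>2 * g * R \<Longrightarrow>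
           (\<Sum>i | i \<le> D \<and> (1 + 2 * \<eta>) * g * R < real i. q i) \<le> exp (- (3/2 * L))"
    and "3 * L \<le> \<eta>\<^sup>2 * g * real D \<Longrightarrow>
           (\<Sum>i | i \<le> D \<and> real i < (1 - 2 * \<eta>) * g * real D. q i) \<le> exp (- (3/2 * L))"
proof -
  have *: "sum q I \<le> exp (- (3/2 * L))"
    if "I \<subseteq> {..D}" and bound: "\<And>i. i \<in> I \<Longrightarrow> q i \<le> exp (- (3/4 * \<eta>) * (\<eta> * g * R - 1))" and "3 * L \<le> \<eta>\<^sup>2 * g * R"
    for I R
  proof -
    have "q i \<le> exp (1 - 9/4 * L)" if "i \<in> I" for i
    proof -
      have "- (3/4 * \<eta>) * (\<eta> * g * R - 1) = 3/4 * \<eta> - 3/4 * (\<eta>\<^sup>2 * g * R)"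
        by (simp add: field_simps power2_eq_square)
      also have "\<dots> \<le> 1 - 9/4 * L"
        using \<eta> \<open>3 * L \<le> \<eta>\<^sup>2 * g * R\<close> by simp
      finally have le: "- (3/4 * \<eta>) * (\<eta> * g * R - 1) \<le> 1 - 9/4 * L" .
      show ?thesis
        by (rule order_trans[OF bound[OF that]]) (simp only: exp_le_cancel_iff le)
    qed
    then have "sum q I \<le> real (card I) * exp (1 - 9/4 * L)"
      by (rule sum_bounded_above)
    also have "\<dots> \<le> exp (L/2 + 1) * exp (1 - 9/4 * L)"
    proof (intro mult_right_mono)
      have "card I \<le> D + 1" using card_mono[OF _ that(1)] by simp
      then show "real (card I) \<le> exp (L/2 + 1)" using D by linarith
    qed simp
    \<comment> \<open>The exponents add up to \<open>2 - 7/4 * L\<close>, which is at most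
      \<open>- (3/2 * L)\<close> precisely when \<open>8 \<le> L\<close>.\<close>
    also have "\<dots> \<le> exp (- (3/2 * L))"
      using L by (simp add: exp_add[symmetric])
    finally show ?thesis .
  qed
  show "(\<Sum>i | i \<le> D \<and> (1 + 2 * \<eta>) * g * R < real i. q i) \<le> exp (- (3/2 * L))"
    if "real D \<le> R" "3 * L \<le> \<eta>\<^sup>2 * g * R"
  proof (rule *[where R = R])
    fix i assume i: "i \<in> {i. i \<le> D \<and> (1 + 2 * \<eta>) * g * R < real i}"
    have "\<eta> * g * R - 1 \<le> real i - (1 + \<eta>) * g * R - 1"
      using i by (simp add: algebra_simps)
    then have le: "- (3/4 * \<eta>) * (real i - (1 + \<eta>) * g * R - 1) \<le> - (3/4 * \<eta>) * (\<eta> * g * R - 1)"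
      using \<eta> by (intro mult_left_mono_neg) auto
    show "q i \<le> exp (- (3/4 * \<eta>) * (\<eta> * g * R - 1))"
      by (rule order_trans[OF near_binomial_upper[OF q g \<eta> \<epsilon> that(1)]]) (simp only: exp_le_cancel_iff le)
  qed (use that in auto)
  show "(\<Sum>i | i \<le> D \<and> real i < (1 - 2 * \<eta>) * g * real D. q i) \<le> exp (- (3/2 * L))"
    if "3 * L \<le> \<eta>\<^sup>2 * g * real D"
  proof (rule *[where R = "real D"])
    fix i assume i: "i \<in> {i. i \<le> D \<and> real i < (1 - 2 * \<eta>) * g * real D}"
    have "\<eta> * g * real D - 1 \<le> (1 - \<eta>) * g * real D - 1 - real i"
      using i by (simp add: algebra_simps)
    then have le: "- (3/4 * \<eta>) * ((1 - \<eta>) * g * real D - 1 - real i) \<le> - (3/4 * \<eta>) * (\<eta> * g * real D - 1)"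
      using \<eta> by (intro mult_left_mono_neg) auto
    then show "q i \<le> exp (- (3/4 * \<eta>) * (\<eta> * g * real D - 1))"
      using i by (intro order_trans[OF near_binomial_lower[OF q g \<eta> \<epsilon>]]) (simp_all only: exp_le_cancel_iff le mem_Collect_eq)
  qed (use that in auto)
qed

text \<open>A switching avoids \<open>u\<close>, hence stays in \<open>F\<close>. With
  \<open>x\<close> outside \<open>S\<close> and \<open>a\<close> inside, it raises the number of
  neighbours of \<open>v\<close> in \<open>S\<close> by one: there are \<open>D - i\<close> choices
  of \<open>x\<close>, against \<open>i + 1\<close> for the reverse move. The remaining factors,
  \<open>DS\<close> and \<open>M - DS\<close> up to the correction \<open>B\<close>, give the odds
  \<open>g : 1 - g\<close>.\<close>

lemma near_binomial_switching:
  fixes n :: nat and d :: "nat \<Rightarrow> nat" and S :: "nat set" and c :: real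
  defines "DS \<equiv> real (\<Sum>i\<in>S. d i)" and "M \<equiv> real (\<Sum>i=1..n. d i)"
  assumes \<Delta>: "\<And>i. i \<in> {1..n} \<Longrightarrow> d i \<le> \<Delta>" and S: "S \<subseteq> {1..n}"
    and c: "0 < c" "DS / M \<le> 1 - c" and DS: "0 < DS"
    and "u \<noteq> v"
    and F: "F \<subseteq> graphs_with_degrees n d" "F \<noteq> {}"
    and closed: "\<And>G G'. G \<in> F \<Longrightarrow> G' \<in> graphs_with_degrees n d \<Longrightarrow> nbr G' u = nbr G u \<Longrightarrow> G' \<in> F"
    and D: "\<And>G. G \<in> F \<Longrightarrow> card (nbr G v - {u}) = D"
  shows "near_binomial (2 * real \<Delta> * (real \<Delta> + 2) / (c * DS)) D (DS / M)
           (\<lambda>i. real (card {G\<in>F. card (nbr G v \<inter> S - {u}) = i}) / real (card F))"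
proof -
  define g where "g = DS / M"
  define B where "B = 2 * real \<Delta> * (real \<Delta> + 2)"
  define \<epsilon> where "\<epsilon> = B / (c * DS)"
  have finF: "finite F" using F finite_graphs_with_degrees finite_subset by blast
  then have cF: "card F > 0" using F by (simp add: card_gt_0_iff)
  have DSM: "DS \<le> M"
    unfolding DS_def M_def of_nat_le_iff using S by (intro sum_mono2) auto
  then have Mpos: "M > 0" using DS by simp
  have g: "0 < g" "g \<le> 1 - c" using c DS Mpos by (auto simp: g_def)
  have Beq: "B = \<epsilon> * (c * DS)" using c DS by (simp add: \<epsilon>_def)
  have \<epsilon>0: "0 \<le> \<epsilon>" using c DS by (simp add: \<epsilon>_def B_def)
  have B1: "B \<le> \<epsilon> * DS"
    unfolding Beq using \<epsilon>0 DS g c by (intro mult_left_mono) auto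
  \<comment> \<open>\<open>(1 - g) * M\<close> is at least \<open>c * M\<close>, hence at least
    \<open>c * DS\<close>; this is the origin of \<open>c\<close> in the denominator of
    \<open>\<epsilon>\<close>.\<close>
  have B2: "B \<le> \<epsilon> * ((1 - g) * M)"
    unfolding Beq using \<epsilon>0 DS g c DSM by (intro mult_left_mono mult_mono) auto
  have gM: "g * M = DS" "(1 - g) * M = M - DS" using Mpos by (auto simp: g_def algebra_simps)
  have SS: "S \<inter> {1..n} = S" using S by auto
  have "(\<Sum>i=1..n. d i) = (\<Sum>i\<in>{1..n} - S. d i) + (\<Sum>i\<in>S. d i)"
    using S by (intro sum.subset_diff) auto
  moreover have "{1..n} - S = - S \<inter> {1..n}"
    by auto
  ultimately have "(\<Sum>i=1..n. d i) = (\<Sum>i\<in>S. d i) + (\<Sum>i\<in>- S \<inter> {1..n}. d i)"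
    by simp
  then have sumS: "real (\<Sum>i\<in>- S \<inter> {1..n}. d i) = (1 - g) * M"
    unfolding gM(2) by (simp add: DS_def M_def)
  define A where "A = (\<lambda>i. {G\<in>F. card (nbr G v \<inter> S - {u}) = i})"
  have A: "A i \<subseteq> graphs_with_degrees n d" for i using F by (auto simp: A_def)
  have finN: "finite (nbr G y)" if "G \<in> F" for G y
    using F that nbr_props(2)[of G n y] graphs_with_degrees_iff by blast
  have split: "card (nbr G v \<inter> S - {u}) + card (nbr G v \<inter> - S - {u}) = D" if "G \<in> F" for G
  proof -
    have "card (nbr G v - {u}) = card ((nbr G v \<inter> S - {u}) \<union> (nbr G v \<inter> - S - {u}))"
      by (rule arg_cong[where f = card]) auto
    also have "\<dots> = card (nbr G v \<inter> S - {u}) + card (nbr G v \<inter> - S - {u})"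
      using finN[OF that] by (intro card_Un_disjoint) auto
    finally show ?thesis using D[OF that] by simp
  qed
  have inF: "switch G v x a b \<in> F" if "G \<in> F" "(x, a, b) \<in> switchings G u v P Q" for G x a b P Q
    using closed[OF that(1)] switch_in_graphs[of G n d, OF _ that(2) \<open>u \<noteq> v\<close>]
      switch_facts(7)[of G n, OF _ that(2) \<open>u \<noteq> v\<close>] that F
    by (meson graphs_with_degrees_iff subsetD)
  have nb: "nbr (switch G v x a b) v = insert a (nbr G v - {x})"
    if "G \<in> F" "(x, a, b) \<in> switchings G u v P Q" for G x a b P Q
    using switch_facts(2)[of G n, OF _ that(2) \<open>u \<noteq> v\<close>] that F by (meson graphs_with_degrees_iff subsetD)
  have up: "(real D - real i) * (DS - B) * real (card (A i)) \<le> (real i + 1) * ((1 - g) * M) * real (card (A (Suc i)))"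
    if i: "i < D" for i
  proof -
    have "real (D - i) * (real (\<Sum>a\<in>S \<inter> {1..n}. d a) - 2 * real \<Delta> * (real \<Delta> + 2)) * real (card (A i))
           \<le> real (Suc i) * real (\<Sum>a\<in>- S \<inter> {1..n}. d a) * real (card (A (Suc i)))"
    proof (rule switching_inequality[OF \<Delta> \<open>u \<noteq> v\<close> A A, where P = "- S" and Q = S])
      fix G x a b assume G: "G \<in> A i" and sw: "(x, a, b) \<in> switchings G u v (- S) S"
      have GF: "G \<in> F" using G by (simp add: A_def)
      have "x \<notin> S" "a \<in> S" "a \<noteq> u" "a \<notin> nbr G v" using sw by (auto simp: switchings_def)
      then have "nbr (switch G v x a b) v \<inter> S - {u} = insert a (nbr G v \<inter> S - {u})"
        unfolding nb[OF GF sw] by auto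
      then have "card (nbr (switch G v x a b) v \<inter> S - {u}) = Suc i"
        using G \<open>a \<notin> nbr G v\<close> finN[OF GF] by (simp add: A_def)
      then show "switch G v x a b \<in> A (Suc i)"
        using inF[OF GF sw] by (simp add: A_def)
    next
      fix G assume "G \<in> A i"
      then show "card (nbr G v \<inter> - S - {u}) = D - i"
        using split[of G] by (auto simp: A_def)
    next
      fix G assume "G \<in> A (Suc i)"
      then show "card (nbr G v \<inter> S - {u}) \<le> Suc i" by (simp add: A_def)
    qed
    then show ?thesis
      unfolding sumS SS using i by (simp add: DS_def B_def of_nat_diff add.commute)
  qed
  have down: "(real i + 1) * ((1 - g) * M - B) * real (card (A (Suc i))) \<le> (real D - real i) * DS * real (card (A i))"
    if i: "i < D" for i
  proof -
    have "real (Suc i) * (real (\<Sum>a\<in>- S \<inter> {1..n}. d a) - 2 * real \<Delta> * (real \<Delta> + 2)) * real (card (A (Suc i)))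
           \<le> real (D - i) * real (\<Sum>a\<in>S \<inter> {1..n}. d a) * real (card (A i))"
    proof (rule switching_inequality[OF \<Delta> \<open>u \<noteq> v\<close> A A, where P = S and Q = "- S"])
      fix G x a b assume G: "G \<in> A (Suc i)" and sw: "(x, a, b) \<in> switchings G u v S (- S)"
      have GF: "G \<in> F" using G by (simp add: A_def)
      have x: "a \<notin> S" "x \<in> nbr G v \<inter> S - {u}" using sw by (auto simp: switchings_def)
      then have "nbr (switch G v x a b) v \<inter> S - {u} = (nbr G v \<inter> S - {u}) - {x}"
        unfolding nb[OF GF sw] by auto
      then have "card (nbr (switch G v x a b) v \<inter> S - {u}) = i"
        using G x(2) finN[OF GF] by (simp add: A_def)
      then show "switch G v x a b \<in> A i"
        using inF[OF GF sw] by (simp add: A_def)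
    next
      fix G assume "G \<in> A i"
      then show "card (nbr G v \<inter> - S - {u}) \<le> D - i"
        using split[of G] by (auto simp: A_def)
    next
      fix G assume "G \<in> A (Suc i)"
      then show "card (nbr G v \<inter> S - {u}) = Suc i" by (simp add: A_def)
    qed
    then show ?thesis
      unfolding sumS SS using i by (simp add: DS_def B_def of_nat_diff add.commute)
  qed
  define q where "q = (\<lambda>i. real (card (A i)) / real (card F))"
  have ratio: "(1 - \<epsilon>) * ((real D - real i) * g * q i) \<le> (real i + 1) * (1 - g) * q (Suc i) \<and>
            (1 - \<epsilon>) * ((real i + 1) * (1 - g) * q (Suc i)) \<le> (real D - real i) * g * q i" if i: "i < D" for i
  proof
    have Di: "0 \<le> real D - real i" using i by simp
    have "(real D - real i) * ((1 - \<epsilon>) * (g * M)) * real (card (A i)) \<le> (real D - real i) * (DS - B) * real (card (A i))"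
      unfolding gM using B1 Di by (intro mult_right_mono mult_left_mono) (auto simp: algebra_simps)
    also note up[OF i]
    finally have "((1 - \<epsilon>) * ((real D - real i) * g * q i)) * (M * card F) \<le> ((real i + 1) * (1 - g) * q (Suc i)) * (M * card F)"
      using cF by (simp add: q_def ac_simps)
    then show "(1 - \<epsilon>) * ((real D - real i) * g * q i) \<le> (real i + 1) * (1 - g) * q (Suc i)"
      using Mpos cF by (simp add: mult_le_cancel_right)
    have "(real i + 1) * ((1 - \<epsilon>) * ((1 - g) * M)) * real (card (A (Suc i))) \<le> (real i + 1) * ((1 - g) * M - B) * real (card (A (Suc i)))"
      using B2 by (intro mult_right_mono mult_left_mono) (auto simp: algebra_simps)
    also note down[OF i]
    also have "(real D - real i) * DS * real (card (A i)) = (real D - real i) * (g * M) * real (card (A i))"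
      by (simp add: gM)
    finally have "((1 - \<epsilon>) * ((real i + 1) * (1 - g) * q (Suc i))) * (M * card F) \<le> ((real D - real i) * g * q i) * (M * card F)"
      using cF by (simp add: q_def ac_simps)
    then show "(1 - \<epsilon>) * ((real i + 1) * (1 - g) * q (Suc i)) \<le> (real D - real i) * g * q i"
      using Mpos cF by (simp add: mult_le_cancel_right)
  qed
  have bound: "card (nbr G v \<inter> S - {u}) \<le> D" if "G \<in> F" for G
    using split[OF that] by linarith
  have "F = (\<Union>i\<le>D. A i)"
    using bound by (auto simp: A_def)
  then have "card F = (\<Sum>i\<le>D. card (A i))"
    using finF by (subst card_UN_disjoint[symmetric]) (auto simp: A_def)
  then have sum1: "(\<Sum>i\<le>D. q i) = 1"
    unfolding q_def sum_divide_distrib[symmetric] of_nat_sum[symmetric]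
    using cF by (metis divide_self less_numeral_extra(3) of_nat_eq_0_iff)
  have zero: "q i = 0" if "i > D" for i
  proof -
    have "A i = {}" using bound that by (fastforce simp: A_def)
    then show ?thesis by (simp add: q_def)
  qed
  have "near_binomial \<epsilon> D g q"
    unfolding near_binomial_def using ratio sum1 zero by (auto simp: q_def)
  then show ?thesis
    by (simp add: \<epsilon>_def B_def g_def q_def A_def)
qed

section \<open>Tails of the induced degrees and the sequence \<open>d\<^sub>H\<close>\<close>

lemma card_filter_eq_sum:
  assumes "finite F" "\<And>G. G \<in> F \<Longrightarrow> f G \<le> (D :: nat)"
  shows "card {G\<in>F. P (f G)} = (\<Sum>i | i \<le> D \<and> P i. card {G\<in>F. f G = i})"
proof -
  have "{G\<in>F. P (f G)} = (\<Union>i\<in>{i. i \<le> D \<and> P i}. {G\<in>F. f G = i})"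
    using assms(2) by auto
  then show ?thesis
    using assms(1) by (simp add: card_UN_disjoint disjoint_iff)
qed

lemma prob_binomial_pmf_eq_sum:
  assumes "0 < g" "g < 1"
  shows "measure_pmf.prob (binomial_pmf D g) {..k} = (\<Sum>i | i \<le> D \<and> i \<le> k. pmf (binomial_pmf D g) i)"
    and "1 - measure_pmf.prob (binomial_pmf D g) {..k} = (\<Sum>i | i \<le> D \<and> k < i. pmf (binomial_pmf D g) i)"
proof -
  have *: "measure_pmf.prob (binomial_pmf D g) A = (\<Sum>i | i \<le> D \<and> i \<in> A. pmf (binomial_pmf D g) i)" for A
  proof -
    have "measure_pmf.prob (binomial_pmf D g) A = measure_pmf.prob (binomial_pmf D g) (A \<inter> set_pmf (binomial_pmf D g))"
      by (simp add: measure_Int_set_pmf)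
    also have "A \<inter> set_pmf (binomial_pmf D g) = {i. i \<le> D \<and> i \<in> A}"
      using assms by (auto simp: set_pmf_binomial_eq)
    finally show ?thesis
      by (simp add: measure_measure_pmf_finite)
  qed
  show "measure_pmf.prob (binomial_pmf D g) {..k} = (\<Sum>i | i \<le> D \<and> i \<le> k. pmf (binomial_pmf D g) i)"
    using *[of "{..k}"] by simp
  have "1 - measure_pmf.prob (binomial_pmf D g) {..k} = measure_pmf.prob (binomial_pmf D g) (UNIV - {..k})"
    using measure_pmf.prob_compl[of "{..k}" "binomial_pmf D g"] by simp
  also have "UNIV - {..k} = {k<..}" by auto
  finally show "1 - measure_pmf.prob (binomial_pmf D g) {..k} = (\<Sum>i | i \<le> D \<and> k < i. pmf (binomial_pmf D g) i)"
    using *[of "{k<..}"] by simp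
qed

text \<open>One way to have \<open>i\<close> successes is that a designated trial succeeds and the
  other \<open>D - 1\<close> trials give \<open>i - 1\<close>. It handles a vertex one of whose
  edges is already known to lead into \<open>S\<close>.\<close>

lemma binomial_pmf_pred_le:
  assumes "0 \<le> g" "g \<le> 1" "0 < D" "0 < i"
  shows "g * pmf (binomial_pmf (D - 1) g) (i - 1) \<le> pmf (binomial_pmf D g) i"
proof -
  obtain a b where ab: "D = Suc a" "i = Suc b"
    using assms by (metis gr0_implies_Suc)
  have "real (a choose b) * (g ^ Suc b * (1 - g) ^ (a - b)) \<le> real (Suc a choose Suc b) * (g ^ Suc b * (1 - g) ^ (a - b))"
    using assms by (intro mult_right_mono) auto
  then show ?thesis
    using assms by (simp add: ab algebra_simps)
qed

lemma nth_sorted_list_of_set_rank: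
  fixes S :: "nat set"
  assumes "finite S" "k < card S"
  defines "xs \<equiv> sorted_list_of_set S"
  shows "xs ! k \<in> S" "card {w\<in>S. w \<le> xs ! k} = Suc k" "card {w\<in>S. w < xs ! k} = k"
proof -
  have len: "length xs = card S" and set: "set xs = S" and sd: "sorted_wrt (<) xs" and dist: "distinct xs"
    using assms by (auto simp: strict_sorted_list_of_set)
  show "xs ! k \<in> S"
    using set len assms(2) by (metis nth_mem)
  have iff: "xs ! i < xs ! j \<longleftrightarrow> i < j" if "i < card S" "j < card S" for i j
    using that sd len by (metis linorder_neqE_nat less_asym sorted_wrt_nth_less less_irrefl)
  have "{w\<in>S. w < xs ! k} = (\<lambda>i. xs ! i) ` {..<k}"
  proof (intro set_eqI iffI)
    fix w assume w: "w \<in> {w\<in>S. w < xs ! k}"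
    then obtain i where "i < card S" "w = xs ! i"
      using set len by (metis (no_types, lifting) in_set_conv_nth mem_Collect_eq)
    then show "w \<in> (\<lambda>i. xs ! i) ` {..<k}"
      using w iff assms(2) by auto
  next
    fix w assume "w \<in> (\<lambda>i. xs ! i) ` {..<k}"
    then show "w \<in> {w\<in>S. w < xs ! k}"
      using iff assms(2) set len by (auto intro: nth_mem)
  qed
  moreover have "inj_on (\<lambda>i. xs ! i) {..<k}"
    using dist len assms(2) by (auto simp: inj_on_def nth_eq_iff_index_eq)
  ultimately show c: "card {w\<in>S. w < xs ! k} = k"
    by (simp add: card_image)
  have "{w\<in>S. w \<le> xs ! k} = insert (xs ! k) {w\<in>S. w < xs ! k}"
    using \<open>xs ! k \<in> S\<close> by auto
  then show "card {w\<in>S. w \<le> xs ! k} = Suc k"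
    using c assms(1) by simp
qed

text \<open>The first \<open>k\<close> vertices of \<open>S\<close> contribute almost
  \<open>k\<close> to the sum inside \<open>N(j)\<close>; the total deficit of at most 1/4 is undone
  by the rounding term 1/2. The second claim shows that the \<open>LEAST\<close> in
  \<open>dH_entry\<close> ranges over a nonempty set.\<close>

lemma dH_entry_le:
  assumes S: "finite S" and k: "1 \<le> k" "k \<le> card S" and \<tau>: "0 \<le> \<tau>" "real (card S) * \<tau> \<le> 1/4"
    and tail: "\<And>w. w \<in> S \<Longrightarrow> w \<le> sorted_list_of_set S ! (k - 1) \<Longrightarrow>
                 1 - measure_pmf.prob (binomial_pmf (d w) g) {..j} \<le> \<tau>"
  shows "dH_entry d S g k \<le> j" and "int k \<le> Nfun d S g j"
proof -
  define A where "A = {w\<in>S. w \<le> sorted_list_of_set S ! (k - 1)}"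
  have cA: "card A = k" unfolding A_def using nth_sorted_list_of_set_rank(2)[OF S, of "k - 1"] k by simp
  have "real k * \<tau> \<le> real (card S) * \<tau>"
    using k \<tau> by (intro mult_right_mono) auto
  then have "real k - 1/4 \<le> real (card A) * (1 - \<tau>)"
    using \<tau> cA by (simp add: algebra_simps)
  also have "\<dots> \<le> (\<Sum>i\<in>A. measure_pmf.prob (binomial_pmf (d i) g) {..j})"
    using tail by (intro sum_bounded_below) (force simp: A_def)
  also have "\<dots> \<le> (\<Sum>i\<in>S. measure_pmf.prob (binomial_pmf (d i) g) {..j})"
    using S by (intro sum_mono2) (auto simp: A_def)
  finally show "int k \<le> Nfun d S g j"
    unfolding Nfun_def by (simp add: le_floor_iff)
  then show "dH_entry d S g k \<le> j"
    unfolding dH_entry_def by (rule Least_le)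
qed

text \<open>If the entry were below \<open>x\<close>, the vertices from position \<open>k\<close> on
  would contribute at most 1/4 and the others at most \<open>k - 1\<close>, and even adding the
  rounding term 1/2 does not reach \<open>k\<close>.\<close>

lemma dH_entry_ge:
  assumes S: "finite S" and k: "1 \<le> k" "k \<le> card S" and \<tau>: "0 \<le> \<tau>" "real (card S) * \<tau> \<le> 1/4"
    and ex: "\<exists>j. int k \<le> Nfun d S g j"
    and tail: "\<And>w. w \<in> S \<Longrightarrow> sorted_list_of_set S ! (k - 1) \<le> w \<Longrightarrow> real (dH_entry d S g k) < x \<Longrightarrow>
                 measure_pmf.prob (binomial_pmf (d w) g) {..dH_entry d S g k} \<le> \<tau>"
  shows "x \<le> real (dH_entry d S g k)"
proof (rule ccontr)
  assume "\<not> ?thesis"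
  then have lt: "real (dH_entry d S g k) < x" by simp
  define j where "j = dH_entry d S g k"
  have "int k \<le> Nfun d S g j"
    unfolding j_def dH_entry_def using ex by (rule LeastI_ex)
  then have ge: "real k \<le> (\<Sum>i\<in>S. measure_pmf.prob (binomial_pmf (d i) g) {..j}) + 1/2"
    unfolding Nfun_def by (simp add: le_floor_iff)
  define A where "A = {w\<in>S. w < sorted_list_of_set S ! (k - 1)}"
  have cA: "card A = k - 1" unfolding A_def using nth_sorted_list_of_set_rank(3)[OF S, of "k - 1"] k by simp
  have AS: "A \<subseteq> S" by (auto simp: A_def)
  have "(\<Sum>i\<in>S. measure_pmf.prob (binomial_pmf (d i) g) {..j})
      = (\<Sum>i\<in>S - A. measure_pmf.prob (binomial_pmf (d i) g) {..j}) + (\<Sum>i\<in>A. measure_pmf.prob (binomial_pmf (d i) g) {..j})"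
    using S AS by (intro sum.subset_diff)
  also have "(\<Sum>i\<in>S - A. measure_pmf.prob (binomial_pmf (d i) g) {..j}) \<le> real (card (S - A)) * \<tau>"
    using tail lt by (intro sum_bounded_above) (auto simp: A_def j_def)
  also have "\<dots> \<le> real (card S) * \<tau>"
    using S \<tau> by (intro mult_right_mono) (auto intro: card_mono)
  also have "(\<Sum>i\<in>A. measure_pmf.prob (binomial_pmf (d i) g) {..j}) \<le> real (card A) * 1"
    by (intro sum_bounded_above) simp
  finally show False
    using ge \<tau> cA k by (simp add: of_nat_diff)
qed

text \<open>Here \<open>t\<close> stands for \<open>\<delta> powr (1/64)\<close>, which turns all powers of \<open>\<delta>\<close> in the theorem into
  integer powers.\<close>

locale degree_setup =
  fixes n :: nat and d :: "nat \<Rightarrow> nat" and S :: "nat set" and \<Delta> :: nat and c t M DS g L C :: real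
  assumes M: "M = real (\<Sum>i=1..n. d i)" and DS: "DS = real (\<Sum>i\<in>S. d i)"
    and g: "g = DS / M" and L: "L = ln M" and C: "C = L / (t ^ 4 * g)"
    and d_le: "i \<in> {1..n} \<Longrightarrow> d i \<le> \<Delta>" and d_pos: "i \<in> {1..n} \<Longrightarrow> 1 \<le> d i"
    and d_mono: "i \<in> {1..n} \<Longrightarrow> j \<in> {1..n} \<Longrightarrow> i \<le> j \<Longrightarrow> d i \<le> d j"
    and realizable: "graphs_with_degrees n d \<noteq> {}"
    and S_sub: "S \<subseteq> {1..n}" and DS_pos: "0 < DS"
    and c_pos: "0 < c" and g_le: "g \<le> 1 - c"
    and t: "0 < t" "t \<le> 1/1000" "t \<le> c / 100"
    and L8: "8 \<le> L"
    and main: "real \<Delta> ^ 2 * (L / g) ^ 12 \<le> t ^ 64 * DS"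
begin

definition "Gr = graphs_with_degrees n d"
definition "\<epsilon> = 2 * real \<Delta> * (real \<Delta> + 2) / (c * DS)"
definition "\<tau> = exp (- (3/2 * L))"

section \<open>Inequalities between the parameters for a fixed number of vertices\<close>

lemma finS: "finite S"
  using S_sub finite_subset by blast

lemma S_in: "v \<in> S \<Longrightarrow> v \<in> {1..n}"
  using S_sub by blast

lemma finite_Gr: "finite Gr"
  unfolding Gr_def by (rule finite_graphs_with_degrees)

lemma card_Gr_pos: "0 < card Gr"
  using finite_Gr realizable by (simp add: Gr_def card_gt_0_iff)

lemma Delta_pos: "1 \<le> \<Delta>"
proof -
  have "S \<noteq> {}" using DS_pos DS by auto
  then obtain v where "v \<in> {1..n}" using S_sub by blast
  then show ?thesis using d_le[of v] d_pos[of v] by linarith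
qed

lemma DS_le_M: "DS \<le> M"
  unfolding DS M of_nat_le_iff using S_sub by (intro sum_mono2) auto

lemma M_pos: "0 < M"
  using DS_pos DS_le_M by linarith

lemma exp_L: "exp L = M"
  using M_pos L by simp

lemma g_bounds: "0 < g" "g < 1" "g \<le> 1"
proof -
  show "0 < g" using DS_pos M_pos by (simp add: g)
  show "g < 1" "g \<le> 1" using g_le c_pos by linarith+
qed

lemma c_le_1: "c \<le> 1"
  using g_le g_bounds by linarith

lemma C_pos: "0 < C"
  using L8 t g_bounds by (simp add: C)

lemma gC: "g * C = L / t ^ 4"
  using g_bounds by (simp add: C)

lemma gC_ge: "L \<le> g * C"
proof -
  have "t ^ 4 \<le> 1" using t by (intro power_le_one) auto
  then have "L * t ^ 4 \<le> L * 1" using L8 by (intro mult_left_mono) auto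
  then show ?thesis using t by (simp add: gC pos_le_divide_eq)
qed

lemma C_ge: "L \<le> C" "1 \<le> C"
proof -
  have "g * C \<le> 1 * C" using g_bounds C_pos by (intro mult_right_mono) auto
  then show "L \<le> C" using gC_ge by simp
  then show "1 \<le> C" using L8 by simp
qed

lemma Delta_sq: "real \<Delta> ^ 2 / DS \<le> t ^ 64 * (g / L) ^ 12"
proof -
  have "real \<Delta> ^ 2 * (L / g) ^ 12 / (L / g) ^ 12 \<le> t ^ 64 * DS / (L / g) ^ 12"
    using main L8 g_bounds by (intro divide_right_mono) auto
  then have "real \<Delta> ^ 2 \<le> t ^ 64 * DS / (L / g) ^ 12"
    using L8 g_bounds by simp
  also have "\<dots> = t ^ 64 * (g / L) ^ 12 * DS"
    by (simp add: power_divide)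
  finally show ?thesis using DS_pos by (simp add: pos_divide_le_eq)
qed

lemma gL_le: "0 < g / L" "g / L \<le> 1"
  using g_bounds L8 by auto

text \<open>The main hypothesis makes \<Delta>^2 at most M, so a degree takes at most about M^(1/2)
  values; one factor e absorbs the summand 1.\<close>

lemma Delta_le: "real \<Delta> + 1 \<le> exp (L / 2 + 1)"
proof -
  have "real \<Delta> ^ 2 / DS \<le> 1"
  proof (rule order_trans[OF Delta_sq mult_le_one])
    show "t ^ 64 \<le> 1" "(g / L) ^ 12 \<le> 1" "0 \<le> (g / L) ^ 12"
      using t gL_le by (auto intro!: power_le_one)
  qed
  then have "real \<Delta> ^ 2 \<le> M" using DS_pos DS_le_M by (simp add: pos_divide_le_eq)
  also have "M = exp (L / 2) ^ 2"
    by (simp add: exp_L[symmetric] power2_eq_square exp_add[symmetric])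
  finally have "real \<Delta> \<le> exp (L / 2)"
    by (rule power2_le_imp_le) simp
  moreover have "1 \<le> exp (L / 2)" using L8 by simp
  moreover have "2 * exp (L / 2) \<le> exp 1 * exp (L / 2)"
    using exp_ge_add_one_self[of 1] by (intro mult_right_mono) auto
  ultimately have "real \<Delta> + 1 \<le> exp 1 * exp (L / 2)" by linarith
  then show ?thesis by (simp only: exp_add mult.commute)
qed

lemma eps_nonneg: "0 \<le> \<epsilon>"
  using c_pos DS_pos by (simp add: \<epsilon>_def)

lemma eps_le': "\<epsilon> \<le> 6 / c * (real \<Delta> ^ 2 / DS)"
proof -
  have "2 * real \<Delta> * (real \<Delta> + 2) \<le> 2 * real \<Delta> * (3 * real \<Delta>)"
    using Delta_pos by (intro mult_left_mono) auto
  then show ?thesis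
    using c_pos DS_pos by (simp add: \<epsilon>_def field_simps power2_eq_square)
qed

lemma eps_le: "\<epsilon> \<le> t * (g / L) ^ 12 * t ^ 62"
proof -
  have "\<epsilon> \<le> 6 / c * (t ^ 64 * (g / L) ^ 12)"
    using eps_le' mult_left_mono[OF Delta_sq, of "6 / c"] c_pos by simp
  \<comment> \<open>One of the 64 factors \<open>t\<close> is spent on \<open>6 / c\<close>, which
    \<open>t \<le> c / 100\<close> permits.\<close>
  also have "\<dots> = (6 * t / c) * (t * (g / L) ^ 12 * t ^ 62)"
  proof -
    have "t ^ 64 = t * (t * t ^ 62)" by (simp flip: power_Suc)
    then show ?thesis by (simp only: times_divide_eq_right times_divide_eq_left ac_simps)
  qed
  also have "\<dots> \<le> 1 * (t * (g / L) ^ 12 * t ^ 62)"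
    using t c_pos gL_le by (intro mult_right_mono) (auto simp: pos_divide_le_eq)
  finally show ?thesis by simp
qed

lemma eps_small: "\<epsilon> \<le> t / 16" "\<epsilon> \<le> 1/64"
proof -
  have "(g / L) ^ 12 \<le> 1" using gL_le by (intro power_le_one) auto
  moreover have "t ^ 62 \<le> 1/16"
  proof -
    have "t ^ 62 \<le> t ^ 2" using t by (intro power_decreasing) auto
    also have "\<dots> \<le> (1/4) ^ 2" using t by (intro power_mono) auto
    finally show ?thesis by (simp add: power2_eq_square)
  qed
  ultimately have "t * ((g / L) ^ 12 * t ^ 62) \<le> t * (1 * (1/16))"
    using t gL_le by (intro mult_left_mono mult_mono) auto
  then show 1: "\<epsilon> \<le> t / 16" using eps_le by simp
  then show "\<epsilon> \<le> 1/64" using t by linarith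
qed

section \<open>Tail estimates for induced degrees, binomial variables and the entries of d_H\<close>

lemma deg_in_Gr:
  assumes "G \<in> Gr" "v \<in> S"
  shows "deg_in G S v = card (nbr G v \<inter> S)" "card (nbr G v) = d v" "finite (nbr G v)" "deg_in G S v \<le> d v"
proof -
  have G: "G \<subseteq> vertex_pairs n" and "card (nbr G v) = d v"
    using assms S_sub by (auto simp: Gr_def graphs_with_degrees_iff)
  then show "deg_in G S v = card (nbr G v \<inter> S)" "card (nbr G v) = d v" "finite (nbr G v)"
    using deg_in_eq_card_nbr[OF G assms(2)] nbr_props(2)[OF G] by auto
  then show "deg_in G S v \<le> d v"
    by (metis Int_lower1 card_mono)
qed

lemma near_binomial_family:
  assumes "u \<noteq> v" "F \<subseteq> Gr" "F \<noteq> {}"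
    and "\<And>G G'. G \<in> F \<Longrightarrow> G' \<in> Gr \<Longrightarrow> nbr G' u = nbr G u \<Longrightarrow> G' \<in> F"
    and "\<And>G. G \<in> F \<Longrightarrow> card (nbr G v - {u}) = D"
  shows "near_binomial \<epsilon> D g (\<lambda>i. real (card {G\<in>F. card (nbr G v \<inter> S - {u}) = i}) / real (card F))"
proof -
  have "near_binomial (2 * real \<Delta> * (real \<Delta> + 2) / (c * DS)) D (DS / M)
      (\<lambda>i. real (card {G\<in>F. card (nbr G v \<inter> S - {u}) = i}) / real (card F))"
    unfolding DS M
  proof (rule near_binomial_switching[OF d_le S_sub c_pos])
    show "real (sum d S) / real (sum d {1..n}) \<le> 1 - c" using g_le by (simp only: g DS M)
    show "0 < real (sum d S)" using DS_pos by (simp only: DS)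
  qed (use assms in \<open>auto simp: Gr_def\<close>)
  then show ?thesis by (simp only: \<epsilon>_def g)
qed

text \<open>The choice \<open>u = 0\<close>, which is not a vertex, makes the family of all graphs
  closed and removes the conditioning.\<close>

lemma near_binomial_deg_in:
  assumes "v \<in> S"
  shows "near_binomial \<epsilon> (d v) g (\<lambda>i. real (card {G\<in>Gr. deg_in G S v = i}) / real (card Gr))"
proof -
  have v: "v \<noteq> 0" using assms S_sub by auto
  have 0: "0 \<notin> nbr G v" if "G \<in> Gr" for G
    using that nbr_props(1)[of G n v] by (auto simp: Gr_def graphs_with_degrees_iff)
  have eq: "card (nbr G v \<inter> S - {0}) = deg_in G S v" if "G \<in> Gr" for G
    using 0[OF that] deg_in_Gr[OF that assms] by simp
  have "near_binomial \<epsilon> (d v) g (\<lambda>i. real (card {G\<in>Gr. card (nbr G v \<inter> S - {0}) = i}) / real (card Gr))"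
    using v card_Gr_pos 0 deg_in_Gr[OF _ assms]
    by (intro near_binomial_family) auto
  moreover have "{G\<in>Gr. card (nbr G v \<inter> S - {0}) = i} = {G\<in>Gr. deg_in G S v = i}" for i
    using eq by auto
  ultimately show ?thesis by simp
qed

lemma d_exp: "w \<in> S \<Longrightarrow> real (d w) + 1 \<le> exp (L / 2 + 1)"
  using d_le[of w] S_sub Delta_le by (meson add_right_mono of_nat_le_iff order_trans subsetD)

lemma graph_tails:
  assumes v: "v \<in> S" and \<eta>: "0 < \<eta>" "\<eta> \<le> 1/4" "\<epsilon> \<le> \<eta> / 16"
  shows "real (d v) \<le> R \<Longrightarrow> 3 * L \<le> \<eta>\<^sup>2 * g * R \<Longrightarrow>
           real (card {G\<in>Gr. (1 + 2 * \<eta>) * g * R < real (deg_in G S v)}) \<le> \<tau> * real (card Gr)"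
    and "3 * L \<le> \<eta>\<^sup>2 * g * real (d v) \<Longrightarrow>
           real (card {G\<in>Gr. real (deg_in G S v) < (1 - 2 * \<eta>) * g * real (d v)}) \<le> \<tau> * real (card Gr)"
proof -
  have *: "real (card {G\<in>Gr. P (deg_in G S v)}) \<le> \<tau> * real (card Gr)"
    if "(\<Sum>i | i \<le> d v \<and> P i. real (card {G\<in>Gr. deg_in G S v = i}) / real (card Gr)) \<le> \<tau>" for P
  proof -
    have "card {G\<in>Gr. P (deg_in G S v)} = (\<Sum>i | i \<le> d v \<and> P i. card {G\<in>Gr. deg_in G S v = i})"
      using finite_Gr deg_in_Gr(4)[OF _ v] by (rule card_filter_eq_sum)
    then show ?thesis
      using that card_Gr_pos by (simp add: sum_divide_distrib[symmetric] pos_divide_le_eq)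
  qed
  note tails = near_binomial_tails[OF near_binomial_deg_in[OF v] g_bounds(1,2) \<eta>(1,2) eps_nonneg \<eta>(3) L8 d_exp[OF v]]
  show "real (d v) \<le> R \<Longrightarrow> 3 * L \<le> \<eta>\<^sup>2 * g * R \<Longrightarrow>
           real (card {G\<in>Gr. (1 + 2 * \<eta>) * g * R < real (deg_in G S v)}) \<le> \<tau> * real (card Gr)"
    using *[of "\<lambda>i. (1 + 2 * \<eta>) * g * R < real i"] tails(1)[of R] by (simp add: \<tau>_def)
  show "3 * L \<le> \<eta>\<^sup>2 * g * real (d v) \<Longrightarrow>
           real (card {G\<in>Gr. real (deg_in G S v) < (1 - 2 * \<eta>) * g * real (d v)}) \<le> \<tau> * real (card Gr)"
    using *[of "\<lambda>i. real i < (1 - 2 * \<eta>) * g * real (d v)"] tails(2) by (simp add: \<tau>_def)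
qed

text \<open>The instance \<open>\<epsilon> = 0\<close> of the general tail bounds. Using the same
  thresholds as for the random graph places d_S(k) and d_H(k) in the same interval.\<close>

lemma binomial_tails:
  assumes w: "w \<in> S" and \<eta>: "0 < \<eta>" "\<eta> \<le> 1/4"
  shows "real (d w) \<le> R \<Longrightarrow> 3 * L \<le> \<eta>\<^sup>2 * g * R \<Longrightarrow> (1 + 2 * \<eta>) * g * R < real j + 1 \<Longrightarrow>
           1 - measure_pmf.prob (binomial_pmf (d w) g) {..j} \<le> \<tau>"
    and "3 * L \<le> \<eta>\<^sup>2 * g * real (d w) \<Longrightarrow> real j < (1 - 2 * \<eta>) * g * real (d w) \<Longrightarrow>
           measure_pmf.prob (binomial_pmf (d w) g) {..j} \<le> \<tau>"
proof -
  have nb: "near_binomial 0 (d w) g (pmf (binomial_pmf (d w) g))"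
    using near_binomial_pmf g_bounds by simp
  have e: "0 \<le> (0::real)" "0 \<le> \<eta> / 16" using \<eta> by auto
  note tails = near_binomial_tails[OF nb g_bounds(1,2) \<eta> e L8 d_exp[OF w]]
  show "1 - measure_pmf.prob (binomial_pmf (d w) g) {..j} \<le> \<tau>"
    if "real (d w) \<le> R" "3 * L \<le> \<eta>\<^sup>2 * g * R" "(1 + 2 * \<eta>) * g * R < real j + 1"
  proof -
    have "(\<Sum>i | i \<le> d w \<and> j < i. pmf (binomial_pmf (d w) g) i)
            \<le> (\<Sum>i | i \<le> d w \<and> (1 + 2 * \<eta>) * g * R < real i. pmf (binomial_pmf (d w) g) i)"
      using that(3) by (intro sum_mono2) auto
    then show ?thesis
      using tails(1)[OF that(1,2)] prob_binomial_pmf_eq_sum(2)[OF g_bounds(1,2)] by (simp add: \<tau>_def)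
  qed
  show "measure_pmf.prob (binomial_pmf (d w) g) {..j} \<le> \<tau>"
    if "3 * L \<le> \<eta>\<^sup>2 * g * real (d w)" "real j < (1 - 2 * \<eta>) * g * real (d w)"
  proof -
    have "(\<Sum>i | i \<le> d w \<and> i \<le> j. pmf (binomial_pmf (d w) g) i)
            \<le> (\<Sum>i | i \<le> d w \<and> real i < (1 - 2 * \<eta>) * g * real (d w). pmf (binomial_pmf (d w) g) i)"
      using that(2) by (intro sum_mono2) auto
    then show ?thesis
      using tails(2)[OF that(1)] prob_binomial_pmf_eq_sum(1)[OF g_bounds(1,2)] by (simp add: \<tau>_def)
  qed
qed

lemma card_S_le: "real (card S) \<le> M"
proof -
  have "card S \<le> (\<Sum>i\<in>S. d i)"
    using sum_mono[of S "\<lambda>_. 1" d] d_pos[OF S_in] by simp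
  then have "real (card S) \<le> DS" by (simp only: DS of_nat_le_iff)
  then show ?thesis using DS_le_M by linarith
qed

text \<open>\<open>\<tau>\<close> is M^(-3/2) and \<open>S\<close> has at most M elements. The 1/4
  is the slack that the rounding in d_H tolerates.\<close>

lemma card_S_tau: "real (card S) * \<tau> \<le> exp (- (L / 2))" "real (card S) * \<tau> \<le> 1/4"
proof -
  have "real (card S) * \<tau> \<le> exp L * \<tau>"
    using card_S_le by (intro mult_right_mono) (auto simp: exp_L \<tau>_def)
  also have "\<dots> = exp (- (L / 2))"
    by (simp add: \<tau>_def exp_add[symmetric])
  finally show 1: "real (card S) * \<tau> \<le> exp (- (L / 2))" .
  have "4 \<le> exp (L / 2)"
    using exp_ge_add_one_self[of "L / 2"] L8 by linarith
  then have "exp (- (L / 2)) \<le> 1/4"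
    by (simp add: exp_minus field_simps)
  then show "real (card S) * \<tau> \<le> 1/4" using 1 by simp
qed

abbreviation "vtx k \<equiv> sorted_list_of_set S ! (k - 1)"

lemma vtx_in_S: "k \<in> {1..card S} \<Longrightarrow> vtx k \<in> S"
  using nth_sorted_list_of_set_rank(1)[OF finS, of "k - 1"] by auto

text \<open>Degrees increase along \<open>S\<close>, so a bound \<open>R\<close> for the
  \<open>k\<close>-th vertex holds for all earlier ones, and these are the vertices that
  \<open>dH_entry_le\<close> asks about.\<close>

lemma dH_upper:
  assumes k: "k \<in> {1..card S}" and \<eta>: "0 < \<eta>" "\<eta> \<le> 1/4"
    and R: "real (d (vtx k)) \<le> R" "3 * L \<le> \<eta>\<^sup>2 * g * R"
  shows "real (dH_entry d S g k) \<le> (1 + 2 * \<eta>) * g * R" "\<exists>j. int k \<le> Nfun d S g j"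
proof -
  define j where "j = nat \<lfloor>(1 + 2 * \<eta>) * g * R\<rfloor>"
  have nn: "0 \<le> (1 + 2 * \<eta>) * g * R"
    using \<eta> g_bounds R(1) by (intro mult_nonneg_nonneg) (auto intro: order_trans[OF of_nat_0_le_iff])
  have j: "(1 + 2 * \<eta>) * g * R < real j + 1" "real j \<le> (1 + 2 * \<eta>) * g * R"
    using nn unfolding j_def by linarith+
  have tail: "1 - measure_pmf.prob (binomial_pmf (d w) g) {..j} \<le> \<tau>" if "w \<in> S" "w \<le> vtx k" for w
  proof (rule binomial_tails(1)[OF that(1) \<eta> _ R(2) j(1)])
    have "d w \<le> d (vtx k)"
      using d_mono[OF S_in S_in, of w "vtx k"] that vtx_in_S[OF k] by simp
    then show "real (d w) \<le> R" using R(1) by linarith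
  qed
  have k': "1 \<le> k" "k \<le> card S" and \<tau>0: "0 \<le> \<tau>" using k by (auto simp: \<tau>_def)
  note u = dH_entry_le[where d = d, OF finS k' \<tau>0 card_S_tau(2) tail]
  show "real (dH_entry d S g k) \<le> (1 + 2 * \<eta>) * g * R"
    using u(1) j(2) by (meson of_nat_le_iff order_trans)
  show "\<exists>j. int k \<le> Nfun d S g j"
    using u(2) by blast
qed

text \<open>Here the later vertices matter; their degrees, and so their lower thresholds, are at
  least those of the \<open>k\<close>-th.\<close>

lemma dH_lower:
  assumes k: "k \<in> {1..card S}" and \<eta>: "0 < \<eta>" "\<eta> \<le> 1/4" and R: "3 * L \<le> \<eta>\<^sup>2 * g * real (d (vtx k))"
  shows "(1 - 2 * \<eta>) * g * real (d (vtx k)) \<le> real (dH_entry d S g k)"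
proof (rule dH_entry_ge[OF finS _ _ _ card_S_tau(2)])
  show "\<exists>j. int k \<le> Nfun d S g j" using dH_upper(2)[OF k \<eta> order_refl R] .
  fix w assume w: "w \<in> S" "vtx k \<le> w" and lt: "real (dH_entry d S g k) < (1 - 2 * \<eta>) * g * real (d (vtx k))"
  have le: "real (d (vtx k)) \<le> real (d w)"
    using d_mono[OF S_in S_in, of "vtx k" w] w vtx_in_S[OF k] by simp
  show "measure_pmf.prob (binomial_pmf (d w) g) {..dH_entry d S g k} \<le> \<tau>"
  proof (rule binomial_tails(2)[OF w(1) \<eta>])
    have "\<eta>\<^sup>2 * g * real (d (vtx k)) \<le> \<eta>\<^sup>2 * g * real (d w)"
      using le g_bounds by (intro mult_left_mono) auto
    then show "3 * L \<le> \<eta>\<^sup>2 * g * real (d w)" using R by linarith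
    have "(1 - 2 * \<eta>) * g * real (d (vtx k)) \<le> (1 - 2 * \<eta>) * g * real (d w)"
      using le g_bounds \<eta> by (intro mult_left_mono) auto
    then show "real (dH_entry d S g k) < (1 - 2 * \<eta>) * g * real (d w)" using lt by linarith
  qed
qed (use k in \<open>auto simp: \<tau>_def\<close>)

end

section \<open>Second moment of the degree counts\<close>

lemma card_filter_eq_sum_if:
  assumes "finite A"
  shows "real (card {x\<in>A. P x}) = (\<Sum>x\<in>A. if P x then 1 else 0)"
  using assms by (simp flip: sum.inter_filter)

context degree_setup
begin

text \<open>\<open>\<kappa>\<close> bounds the relative error in \<open>P(d\<^sub>S(v) = i)\<close> for degrees at most \<open>C\<close>, and \<open>g * \<mu>\<close> the
  probability that two such vertices are adjacent, given the induced degree of one of them.\<close>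

definition "\<kappa> = \<epsilon> * C"
definition "\<mu> = 2 * C ^ 2 / (g * DS)"

text \<open>Since \<open>t ^ 4 * (g / L) * C = 1\<close>, each power of \<open>C\<close> is
  cancelled by four factors \<open>t\<close> and one factor \<open>g / L\<close>. At most twelve are
  taken, which leaves at least \<open>64 - 48 = 16\<close> factors \<open>t\<close> to absorb
  constants.\<close>

lemma Delta_C_power:
  assumes "k \<le> 12"
  shows "real \<Delta> ^ 2 / DS * C ^ k \<le> t ^ 16 * (g / L) ^ (12 - k)"
proof -
  have one: "t ^ 4 * (g / L) * C = 1"
    using t g_bounds L8 by (simp add: C)
  have t64: "t ^ 64 = t ^ (64 - 4 * k) * (t ^ 4) ^ k"
    using assms by (simp flip: power_mult power_add)
  have r12: "(g / L) ^ 12 = (g / L) ^ (12 - k) * (g / L) ^ k"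
    using assms by (simp only: power_add[symmetric]) simp
  have "real \<Delta> ^ 2 / DS * C ^ k \<le> t ^ 64 * (g / L) ^ 12 * C ^ k"
    using Delta_sq C_pos by (intro mult_right_mono) auto
  also have "\<dots> = t ^ (64 - 4 * k) * (g / L) ^ (12 - k) * (t ^ 4 * (g / L) * C) ^ k"
    unfolding t64 r12 power_mult_distrib by (simp only: ac_simps)
  also have "\<dots> = t ^ (64 - 4 * k) * (g / L) ^ (12 - k)"
    by (simp only: one power_one mult_1_right)
  also have "\<dots> \<le> t ^ 16 * (g / L) ^ (12 - k)"
    using assms t gL_le by (intro mult_right_mono power_decreasing) auto
  finally show ?thesis .
qed

lemma inverse_DS_le: "1 / DS \<le> real \<Delta> ^ 2 / DS"
proof -
  have "1 \<le> real \<Delta> ^ 2" using Delta_pos by (intro one_le_power) auto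
  then show ?thesis using DS_pos by (intro divide_right_mono) auto
qed

lemma t16: "t ^ 16 \<le> t" "84 / c * t ^ 16 \<le> 1"
proof -
  show 1: "t ^ 16 \<le> t" using power_decreasing[of 1 16 t] t by simp
  have "84 / c * t ^ 16 \<le> 84 / c * t" using 1 c_pos by (intro mult_left_mono) auto
  also have "\<dots> \<le> 1" using t c_pos by (simp add: field_simps)
  finally show "84 / c * t ^ 16 \<le> 1" .
qed

lemma gL_power_le: "(g / L) ^ k \<le> 1" "0 \<le> (g / L) ^ k"
  using gL_le by (auto intro!: power_le_one)

lemma kappa_le: "\<kappa> \<le> 6 / c * (real \<Delta> ^ 2 / DS * C)"
proof -
  have "\<epsilon> * C \<le> (6 / c * (real \<Delta> ^ 2 / DS)) * C"
    using eps_le' C_pos by (intro mult_right_mono) auto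
  then show ?thesis by (simp add: \<kappa>_def mult.assoc)
qed

lemma kappa_bounds: "0 \<le> \<kappa>" "\<kappa> \<le> 1/2"
proof -
  show "0 \<le> \<kappa>" using eps_nonneg C_pos by (simp add: \<kappa>_def)
  have "real \<Delta> ^ 2 / DS * C \<le> t ^ 16 * (g / L) ^ 11"
    using Delta_C_power[of 1] by simp
  also have "\<dots> \<le> t ^ 16 * 1"
    using gL_power_le t by (intro mult_left_mono) auto
  finally have "\<kappa> \<le> 6 / c * t ^ 16"
    using kappa_le mult_left_mono[of "real \<Delta> ^ 2 / DS * C" "t ^ 16" "6 / c"] c_pos by simp
  then show "\<kappa> \<le> 1/2" using t16(2) by simp
qed

lemma mu_le: "\<mu> \<le> 2 / g * (real \<Delta> ^ 2 / DS * C ^ 2)"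
proof -
  have "1 / DS * C ^ 2 \<le> real \<Delta> ^ 2 / DS * C ^ 2"
    using inverse_DS_le C_pos by (intro mult_right_mono) auto
  then have "2 / g * (1 / DS * C ^ 2) \<le> 2 / g * (real \<Delta> ^ 2 / DS * C ^ 2)"
    using g_bounds by (intro mult_left_mono) auto
  then show ?thesis by (simp add: \<mu>_def)
qed

lemma mu_bounds: "0 \<le> \<mu>" "\<mu> \<le> 1"
proof -
  show "0 \<le> \<mu>" using g_bounds DS_pos by (simp add: \<mu>_def)
  have "2 / g * (real \<Delta> ^ 2 / DS * C ^ 2) \<le> 2 / g * (t ^ 16 * (g / L) ^ 10)"
    using Delta_C_power[of 2] g_bounds by (intro mult_left_mono) auto
  also have "\<dots> = (2 * t ^ 16) * ((g / L) ^ 9) * (1 / L)"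
  proof -
    have "x ^ 10 = x ^ 9 * x" for x :: real by (simp flip: power_Suc2)
    note pw = this[of "g / L"]
    show ?thesis unfolding pw using g_bounds by simp
  qed
  also have "\<dots> \<le> 1 * 1 * 1"
    using t16(1) t gL_power_le gL_le L8 by (intro mult_mono) auto
  finally show "\<mu> \<le> 1" using mu_le by simp
qed

lemma error_le: "(14 * \<kappa> + \<mu>) * C ^ 7 / g \<le> 2 / L"
proof -
  have "14 * \<kappa> * C ^ 7 / g \<le> 14 * (6 / c * (real \<Delta> ^ 2 / DS * C)) * C ^ 7 / g"
    using kappa_le C_pos g_bounds by (intro divide_right_mono mult_right_mono mult_left_mono) auto
  also have "\<dots> = 84 / c * (real \<Delta> ^ 2 / DS * C ^ 8) / g"
  proof -
    have "C ^ 8 = C * C ^ 7" by (simp flip: power_Suc)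
    then show ?thesis by simp
  qed
  also have "\<dots> \<le> 84 / c * (t ^ 16 * (g / L) ^ 4) / g"
    using Delta_C_power[of 8] c_pos g_bounds by (intro divide_right_mono mult_left_mono) auto
  also have "\<dots> = (84 / c * t ^ 16) * (g / L) ^ 3 * (1 / L)"
  proof -
    have "x ^ 4 = x ^ 3 * x" for x :: real by (simp flip: power_Suc2)
    note pw = this[of "g / L"]
    show ?thesis unfolding pw using g_bounds by simp
  qed
  also have "\<dots> \<le> 1 * 1 * (1 / L)"
    using t16(2) gL_power_le gL_le L8 c_pos t by (intro mult_mono) auto
  finally have 1: "14 * \<kappa> * C ^ 7 / g \<le> 1 / L" by simp
  have "\<mu> * C ^ 7 / g \<le> (2 / g * (real \<Delta> ^ 2 / DS * C ^ 2)) * C ^ 7 / g"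
    using mu_le C_pos g_bounds by (intro divide_right_mono mult_right_mono) auto
  also have "\<dots> = 2 / g * (real \<Delta> ^ 2 / DS * C ^ 9) / g"
  proof -
    have "C ^ 9 = C ^ 2 * C ^ 7" by (simp flip: power_add)
    then show ?thesis by simp
  qed
  also have "\<dots> \<le> 2 / g * (t ^ 16 * (g / L) ^ 3) / g"
    using Delta_C_power[of 9] g_bounds by (intro divide_right_mono mult_left_mono) auto
  also have "\<dots> = (2 * t ^ 16) * (g / L) * (1 / L) * (1 / L)"
    using g_bounds by (simp add: power3_eq_cube)
  also have "\<dots> \<le> 1 * 1 * 1 * (1 / L)"
    using t16(1) t gL_le L8 by (intro mult_mono) auto
  finally show ?thesis
    using 1 by (simp add: add_divide_distrib distrib_right)
qed

text \<open>Bernoulli's inequality bounds \<open>(1 - \<epsilon>) ^ D\<close> below by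
  \<open>1 - \<kappa>\<close>, and \<open>1 / (1 - \<kappa>) \<le> 1 + 2 * \<kappa>\<close> because
  \<open>\<kappa> \<le> 1/2\<close>.\<close>

lemma near_binomial_point:
  assumes q: "near_binomial \<epsilon> D g q" and D: "real D \<le> C"
  shows "q i \<le> (1 + 2 * \<kappa>) * pmf (binomial_pmf D g) i"
    and "(1 - \<kappa>) * pmf (binomial_pmf D g) i \<le> q i"
proof -
  let ?p = "pmf (binomial_pmf D g) i"
  have "1 + real D * (- \<epsilon>) \<le> (1 + (- \<epsilon>)) ^ D"
    using eps_small by (intro Bernoulli_inequality) auto
  moreover have "real D * \<epsilon> \<le> \<kappa>"
    using D eps_nonneg by (simp add: \<kappa>_def mult.commute mult_right_mono)
  ultimately have b: "1 - \<kappa> \<le> (1 - \<epsilon>) ^ D" by simp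
  have e: "0 \<le> \<epsilon>" "\<epsilon> \<le> 1" using eps_nonneg eps_small by auto
  note pw = near_binomial_pointwise[OF q g_bounds(1,2) e, of i]
  show "(1 - \<kappa>) * ?p \<le> q i"
    using mult_right_mono[OF b, of ?p] pw(2) by simp
  have "(1 - \<kappa>) * q i \<le> ?p"
    using mult_right_mono[OF b, of "q i"] pw(1) near_binomialD(1)[OF q, of i] by simp
  then have "(1 + 2 * \<kappa>) * ((1 - \<kappa>) * q i) \<le> (1 + 2 * \<kappa>) * ?p"
    using kappa_bounds by (intro mult_left_mono) auto
  moreover have "1 * q i \<le> ((1 + 2 * \<kappa>) * (1 - \<kappa>)) * q i"
  proof (intro mult_right_mono)
    have "\<kappa> * \<kappa> \<le> 1/2 * \<kappa>" using kappa_bounds by (intro mult_right_mono) auto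
    moreover have "(1 + 2 * \<kappa>) * (1 - \<kappa>) = 1 + \<kappa> - 2 * (\<kappa> * \<kappa>)" by (simp add: algebra_simps)
    ultimately show "1 \<le> (1 + 2 * \<kappa>) * (1 - \<kappa>)" by linarith
  qed (rule near_binomialD(1)[OF q])
  ultimately show "q i \<le> (1 + 2 * \<kappa>) * ?p" by (simp add: mult.assoc)
qed

text \<open>The cutoff keeps the accumulated ratio error, about \<open>\<epsilon> * d v\<close>,
  below \<open>\<kappa>\<close>.\<close>

definition "low = {v\<in>S. real (d v) \<le> C}"
definition "cnt v i = real (card {G\<in>Gr. deg_in G S v = i})"

abbreviation "p v i \<equiv> pmf (binomial_pmf (d v) g) i"

lemma low: "v \<in> low \<Longrightarrow> v \<in> S" "v \<in> low \<Longrightarrow> real (d v) \<le> C" "finite low"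
  using finS by (auto simp: low_def)

lemma cnt_bounds:
  assumes "v \<in> low"
  shows "cnt v i \<le> (1 + 2 * \<kappa>) * p v i * real (card Gr)" "(1 - \<kappa>) * p v i * real (card Gr) \<le> cnt v i" "0 \<le> cnt v i"
proof -
  note pt = near_binomial_point[OF near_binomial_deg_in[OF low(1)[OF assms]] low(2)[OF assms], of i, folded cnt_def]
  show "cnt v i \<le> (1 + 2 * \<kappa>) * p v i * real (card Gr)"
    using pt(1) card_Gr_pos by (simp add: pos_divide_le_eq)
  show "(1 - \<kappa>) * p v i * real (card Gr) \<le> cnt v i"
    using pt(2) card_Gr_pos by (simp add: pos_le_divide_eq)
  show "0 \<le> cnt v i" by (simp add: cnt_def)
qed

lemma card_family_le:
  assumes "u \<noteq> v" "F \<subseteq> Gr"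
    and "\<And>G G'. G \<in> F \<Longrightarrow> G' \<in> Gr \<Longrightarrow> nbr G' u = nbr G u \<Longrightarrow> G' \<in> F"
    and "\<And>G. G \<in> F \<Longrightarrow> card (nbr G v - {u}) = D" and "real D \<le> C"
  shows "real (card {G\<in>F. card (nbr G v \<inter> S - {u}) = i}) \<le> (1 + 2 * \<kappa>) * pmf (binomial_pmf D g) i * real (card F)"
proof (cases "F = {}")
  case False
  then have "0 < card F" using assms(2) finite_Gr by (meson card_gt_0_iff finite_subset)
  moreover have "near_binomial \<epsilon> D g (\<lambda>i. real (card {G\<in>F. card (nbr G v \<inter> S - {u}) = i}) / real (card F))"
    using assms False by (intro near_binomial_family) auto
  note near_binomial_point(1)[OF this assms(5), of i]
  ultimately show ?thesis
    by (simp add: pos_divide_le_eq)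
qed simp

text \<open>The edge \<open>uv\<close> is switched to an edge \<open>ua\<close> with
  \<open>a\<close> in \<open>S\<close>, which keeps d_S(u). At least \<open>DS / 2\<close>
  switchings are available, and the reverse move has at most \<open>d u * d v\<close> choices, at
  most \<open>C ^ 2\<close>.\<close>

lemma card_adjacent_le:
  assumes u: "u \<in> low" and v: "v \<in> low" and "u \<noteq> v"
  shows "real (card {G\<in>Gr. deg_in G S u = i \<and> v \<in> nbr G u}) \<le> g * \<mu> * cnt u i"
proof -
  define A where "A = {G\<in>Gr. deg_in G S u = i \<and> v \<in> nbr G u}"
  define B where "B = {G\<in>Gr. deg_in G S u = i}"
  have AB: "A \<subseteq> graphs_with_degrees n d" "B \<subseteq> graphs_with_degrees n d"
    by (auto simp: A_def B_def Gr_def)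
  have uS: "u \<in> S" "v \<in> S" using low u v by auto
  have u0: "0 \<noteq> u" "v \<noteq> 0" using S_in[OF uS(1)] S_in[OF uS(2)] by auto
  have vn: "{v} \<inter> {1..n} = {v}" using S_in[OF uS(2)] by auto
  have SS: "S \<inter> {1..n} = S" using S_sub by auto
  have "real 1 * (real (\<Sum>a\<in>S \<inter> {1..n}. d a) - 2 * real \<Delta> * (real \<Delta> + 2)) * real (card A)
           \<le> real (d u) * real (\<Sum>a\<in>{v} \<inter> {1..n}. d a) * real (card B)"
  proof (rule switching_inequality[OF d_le u0(1) AB])
    fix G x a b assume G: "G \<in> A" and sw: "(x, a, b) \<in> switchings G 0 u {v} S"
    have GG: "G \<in> Gr" using G by (simp add: A_def)
    have Gv: "G \<subseteq> vertex_pairs n" using GG by (simp add: Gr_def graphs_with_degrees_iff)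
    have sG: "switch G u x a b \<in> Gr"
      using switch_in_graphs[OF GG[unfolded Gr_def] sw u0(1)] by (simp add: Gr_def)
    have x: "x = v" "x \<in> nbr G u" "a \<in> S" "a \<notin> nbr G u" using sw by (auto simp: switchings_def)
    have "nbr (switch G u x a b) u \<inter> S = insert a (nbr G u \<inter> S - {x})"
      unfolding switch_facts(2)[OF Gv sw u0(1)] using x by auto
    moreover have "card (insert a (nbr G u \<inter> S - {x})) = Suc (card (nbr G u \<inter> S - {x}))"
      using finS x(4) by (intro card_insert_disjoint) auto
    moreover have "Suc (card (nbr G u \<inter> S - {x})) = card (nbr G u \<inter> S)"
      using finS x uS(2) by (intro card_Suc_Diff1) auto
    ultimately have "card (nbr (switch G u x a b) u \<inter> S) = card (nbr G u \<inter> S)"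
      by simp
    then show "switch G u x a b \<in> B"
      using G sG deg_in_Gr(1)[OF GG uS(1)] deg_in_Gr(1)[OF sG uS(1)] by (simp add: A_def B_def)
  next
    fix G assume G: "G \<in> A"
    then have "nbr G u \<inter> {v} - {0} = {v}" using u0 by (auto simp: A_def)
    then show "card (nbr G u \<inter> {v} - {0}) = 1" by simp
  next
    fix G assume "G \<in> B"
    then have GG: "G \<in> Gr" by (simp add: B_def)
    have "card (nbr G u \<inter> S - {0}) \<le> card (nbr G u)"
      using deg_in_Gr(3)[OF GG uS(1)] by (intro card_mono) auto
    then show "card (nbr G u \<inter> S - {0}) \<le> d u" using deg_in_Gr(2)[OF GG uS(1)] by simp
  qed
  moreover have eps_eq: "\<epsilon> * c * DS = 2 * real \<Delta> * (real \<Delta> + 2)"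
    using c_pos DS_pos by (simp add: \<epsilon>_def)
  ultimately have "(DS - \<epsilon> * c * DS) * real (card A) \<le> real (d u) * real (d v) * cnt u i"
    unfolding SS vn eps_eq by (simp add: DS cnt_def B_def)
  also have "\<dots> \<le> C * C * cnt u i"
    using low(2)[OF u] low(2)[OF v] C_pos cnt_bounds(3)[OF u] by (intro mult_right_mono mult_mono) auto
  finally have 1: "(DS - \<epsilon> * c * DS) * real (card A) \<le> C * C * cnt u i" .
  have "\<epsilon> * c \<le> 1/2 * 1"
    using eps_small(2) eps_nonneg c_le_1 c_pos by (intro mult_mono) auto
  then have "\<epsilon> * c * DS \<le> 1/2 * DS" using DS_pos by (intro mult_right_mono) auto
  then have "1/2 * DS * real (card A) \<le> (DS - \<epsilon> * c * DS) * real (card A)"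
    by (intro mult_right_mono) auto
  then have "DS * real (card A) \<le> 2 * (C * C * cnt u i)" using 1 by simp
  then have "real (card A) \<le> 2 * (C * C * cnt u i) / DS"
    using DS_pos by (simp add: pos_le_divide_eq mult.commute)
  also have "\<dots> = g * \<mu> * cnt u i"
    using g_bounds by (simp add: \<mu>_def power2_eq_square)
  finally show ?thesis by (simp add: A_def)
qed

text \<open>Both d_S(u) and adjacency to \<open>v\<close> are read off from the neighbourhood of
  \<open>u\<close>, so \<open>F1\<close> and \<open>F2\<close> are closed under the switchings at
  \<open>v\<close>. On \<open>F2\<close> the vertex \<open>v\<close> has only \<open>d v - 1\<close>
  free edges; comparing with the full binomial loses \<open>1 / g\<close>, and the factor
  \<open>g\<close> in \<open>card_adjacent_le\<close> makes up for it.\<close>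

lemma card_pair_le:
  assumes u: "u \<in> low" and v: "v \<in> low" and "u \<noteq> v"
  shows "real (card {G\<in>Gr. deg_in G S u = i \<and> deg_in G S v = i}) \<le> (1 + 2 * \<kappa>) * (1 + \<mu>) * p v i * cnt u i"
proof -
  have uS: "u \<in> S" "v \<in> S" using low u v by auto
  define F1 where "F1 = {G\<in>Gr. deg_in G S u = i \<and> v \<notin> nbr G u}"
  define F2 where "F2 = {G\<in>Gr. deg_in G S u = i \<and> v \<in> nbr G u}"
  have closed: "deg_in G' S u = deg_in G S u" if "G \<in> Gr" "G' \<in> Gr" "nbr G' u = nbr G u" for G G'
    unfolding deg_in_Gr(1)[OF that(1) uS(1)] deg_in_Gr(1)[OF that(2) uS(1)] that(3) ..
  have K: "0 \<le> 1 + 2 * \<kappa>" using kappa_bounds by simp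
  have f1: "nbr G v - {u} = nbr G v" "card (nbr G v \<inter> S - {u}) = deg_in G S v" if "G \<in> F1" for G
  proof -
    have G: "G \<in> Gr" "v \<notin> nbr G u" using that by (auto simp: F1_def)
    then have un: "u \<notin> nbr G v" by (metis nbr_sym)
    then show "nbr G v - {u} = nbr G v" by simp
    from un have "nbr G v \<inter> S - {u} = nbr G v \<inter> S" by blast
    then show "card (nbr G v \<inter> S - {u}) = deg_in G S v"
      unfolding deg_in_Gr(1)[OF G(1) uS(2)] by (rule arg_cong)
  qed
  have "real (card {G\<in>F1. card (nbr G v \<inter> S - {u}) = i}) \<le> (1 + 2 * \<kappa>) * p v i * real (card F1)"
  proof (rule card_family_le[OF \<open>u \<noteq> v\<close> _ _ _ low(2)[OF v]])
    show "F1 \<subseteq> Gr" by (auto simp: F1_def)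
    show "G' \<in> F1" if "G \<in> F1" "G' \<in> Gr" "nbr G' u = nbr G u" for G G'
      using that closed[OF _ that(2,3)] by (simp add: F1_def)
    show "card (nbr G v - {u}) = d v" if "G \<in> F1" for G
      using that f1(1)[OF that] deg_in_Gr(2)[OF _ uS(2)] by (simp add: F1_def)
  qed
  moreover have "{G\<in>F1. card (nbr G v \<inter> S - {u}) = i} = {G\<in>F1. deg_in G S v = i}"
    using f1(2) by (intro Collect_cong conj_cong) simp_all
  ultimately have 1: "real (card {G\<in>F1. deg_in G S v = i}) \<le> (1 + 2 * \<kappa>) * p v i * real (card F1)"
    by simp
  have f2: "card (nbr G v - {u}) = d v - 1" "deg_in G S v = Suc (card (nbr G v \<inter> S - {u}))" if "G \<in> F2" for G
  proof -
    have GG: "G \<in> Gr" and "v \<in> nbr G u" using that by (auto simp: F2_def)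
    then have un: "u \<in> nbr G v" by (metis nbr_sym)
    show "card (nbr G v - {u}) = d v - 1"
      using un deg_in_Gr[OF GG uS(2)] by simp
    show "deg_in G S v = Suc (card (nbr G v \<inter> S - {u}))"
      unfolding deg_in_Gr(1)[OF GG uS(2)] using un uS finS by (intro card_Suc_Diff1[symmetric]) auto
  qed
  \<comment> \<open>On \<open>F2\<close> the vertex \<open>u\<close> itself is a neighbour of
    \<open>v\<close> in \<open>S\<close>: this excludes \<open>i = 0\<close> and otherwise leaves
    \<open>i - 1\<close> neighbours to be found.\<close>
  have 2: "real (card {G\<in>F2. deg_in G S v = i}) \<le> (1 + 2 * \<kappa>) * (p v i / g) * real (card F2)"
  proof (cases "i = 0")
    case True
    then have "{G\<in>F2. deg_in G S v = i} = {}" using f2(2) by auto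
    then show ?thesis using K g_bounds by (simp only: card.empty) simp
  next
    case False
    have "real (card {G\<in>F2. card (nbr G v \<inter> S - {u}) = i - 1})
        \<le> (1 + 2 * \<kappa>) * pmf (binomial_pmf (d v - 1) g) (i - 1) * real (card F2)"
    proof (rule card_family_le[OF \<open>u \<noteq> v\<close>])
      show "F2 \<subseteq> Gr" by (auto simp: F2_def)
      show "G' \<in> F2" if "G \<in> F2" "G' \<in> Gr" "nbr G' u = nbr G u" for G G'
        using that closed[OF _ that(2,3)] by (simp add: F2_def)
      show "card (nbr G v - {u}) = d v - 1" if "G \<in> F2" for G
        using f2(1)[OF that] .
      show "real (d v - 1) \<le> C" using low(2)[OF v] by linarith
    qed
    moreover have "{G\<in>F2. card (nbr G v \<inter> S - {u}) = i - 1} = {G\<in>F2. deg_in G S v = i}"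
      using f2(2) False by (intro Collect_cong conj_cong) auto
    ultimately have "real (card {G\<in>F2. deg_in G S v = i})
        \<le> (1 + 2 * \<kappa>) * pmf (binomial_pmf (d v - 1) g) (i - 1) * real (card F2)" by simp
    also have "\<dots> \<le> (1 + 2 * \<kappa>) * (p v i / g) * real (card F2)"
    proof (intro mult_right_mono mult_left_mono K)
      show "pmf (binomial_pmf (d v - 1) g) (i - 1) \<le> p v i / g"
        using binomial_pmf_pred_le[of g "d v" i] g_bounds False d_pos[OF S_in[OF uS(2)]]
        by (simp add: pos_le_divide_eq mult.commute del: pmf_binomial)
    qed simp
    finally show ?thesis .
  qed
  have "{G\<in>Gr. deg_in G S u = i \<and> deg_in G S v = i} = {G\<in>F1. deg_in G S v = i} \<union> {G\<in>F2. deg_in G S v = i}"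
    by (auto simp: F1_def F2_def)
  then have "real (card {G\<in>Gr. deg_in G S u = i \<and> deg_in G S v = i})
      \<le> real (card {G\<in>F1. deg_in G S v = i}) + real (card {G\<in>F2. deg_in G S v = i})"
    using card_Un_le[of "{G\<in>F1. deg_in G S v = i}" "{G\<in>F2. deg_in G S v = i}"] by simp
  also have "\<dots> \<le> (1 + 2 * \<kappa>) * p v i * real (card F1) + (1 + 2 * \<kappa>) * (p v i / g) * real (card F2)"
    using 1 2 by linarith
  also have "\<dots> \<le> (1 + 2 * \<kappa>) * p v i * cnt u i + (1 + 2 * \<kappa>) * (p v i / g) * (g * \<mu> * cnt u i)"
  proof (intro add_mono mult_left_mono)
    show "real (card F1) \<le> cnt u i"
      unfolding cnt_def of_nat_le_iff using finite_Gr by (intro card_mono) (auto simp: F1_def)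
    show "real (card F2) \<le> g * \<mu> * cnt u i"
      using card_adjacent_le[OF u v \<open>u \<noteq> v\<close>] by (simp add: F2_def)
  qed (use K g_bounds in auto)
  also have "\<dots> = (1 + 2 * \<kappa>) * (1 + \<mu>) * p v i * cnt u i"
    using g_bounds by (simp add: field_simps del: pmf_binomial)
  finally show ?thesis .
qed

section \<open>Concentration of the number of vertices with a given induced degree\<close>

definition "Y G i = real (card {v\<in>low. deg_in G S v = i})"
text \<open>The expectation in the binomial model, not the exact mean of \<open>Y\<close>; the
  second moment about it therefore includes a bias, controlled by \<open>\<kappa>\<close>.\<close>

definition "m i = (\<Sum>v\<in>low. p v i)"

lemma m_nonneg: "0 \<le> m i"
  by (simp add: m_def sum_nonneg)

text \<open>The diagonal pairs contribute at most \<open>2 * m i\<close> on average. In the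
  off-diagonal part, the cross term and the square, the leading multiples 1, -2 and 1 of
  \<open>(m i)\<^sup>2\<close> cancel, so only the errors survive.\<close>

lemma second_moment:
  "(\<Sum>G\<in>Gr. (Y G i - m i)\<^sup>2) \<le> real (card Gr) * (2 * m i + (14 * \<kappa> + \<mu>) * (m i)\<^sup>2)"
proof -
  define N where "N = real (card Gr)"
  define T where "T = (\<Sum>v\<in>low. cnt v i)"
  define I where "I = (\<lambda>G v. if deg_in G S v = i then 1 else 0 :: real)"
  have Y: "Y G i = (\<Sum>v\<in>low. I G v)" for G
    unfolding Y_def I_def using low(3) by (rule card_filter_eq_sum_if)
  have cnt: "cnt v i = (\<Sum>G\<in>Gr. I G v)" for v
    unfolding cnt_def I_def using finite_Gr by (rule card_filter_eq_sum_if)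
  have pair: "real (card {G\<in>Gr. deg_in G S u = i \<and> deg_in G S v = i}) = (\<Sum>G\<in>Gr. I G u * I G v)" for u v
  proof -
    have "I G u * I G v = (if deg_in G S u = i \<and> deg_in G S v = i then 1 else 0)" for G
      by (simp add: I_def)
    then show ?thesis
      using card_filter_eq_sum_if[OF finite_Gr] by simp
  qed
  have N0: "0 \<le> N" by (simp add: N_def)
  have T0: "0 \<le> T" unfolding T_def using cnt_bounds(3) by (intro sum_nonneg) auto
  have Tub: "T \<le> (1 + 2 * \<kappa>) * m i * N"
    unfolding T_def m_def N_def sum_distrib_left sum_distrib_right
    using cnt_bounds(1) by (intro sum_mono)
  have Tlb: "(1 - \<kappa>) * m i * N \<le> T"
    unfolding T_def m_def N_def sum_distrib_left sum_distrib_right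
    using cnt_bounds(2) by (intro sum_mono)
  define b where "b = (1 + 2 * \<kappa>) * (1 + \<mu>)"
  have b0: "0 \<le> b" using kappa_bounds mu_bounds by (simp add: b_def)
  have SY: "(\<Sum>G\<in>Gr. Y G i) = T"
    unfolding Y T_def cnt by (rule sum.swap)
  have "(\<Sum>G\<in>Gr. (Y G i)\<^sup>2) = (\<Sum>G\<in>Gr. \<Sum>u\<in>low. \<Sum>v\<in>low. I G u * I G v)"
    by (simp add: Y power2_eq_square sum_product)
  also have "\<dots> = (\<Sum>u\<in>low. \<Sum>v\<in>low. \<Sum>G\<in>Gr. I G u * I G v)"
    by (subst sum.swap) (intro sum.cong refl, subst sum.swap, simp)
  also have "\<dots> \<le> (\<Sum>u\<in>low. \<Sum>v\<in>low. (if u = v then cnt u i else 0) + b * p v i * cnt u i)"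
  proof (intro sum_mono)
    fix u v assume uv: "u \<in> low" "v \<in> low"
    show "(\<Sum>G\<in>Gr. I G u * I G v) \<le> (if u = v then cnt u i else 0) + b * p v i * cnt u i"
    proof (cases "u = v")
      case True
      have "(\<Sum>G\<in>Gr. I G u * I G v) = cnt u i"
        unfolding cnt using True by (intro sum.cong) (auto simp: I_def)
      moreover have "0 \<le> b * p v i * cnt u i"
        using b0 cnt_bounds(3)[OF uv(1)] by (intro mult_nonneg_nonneg) auto
      ultimately show ?thesis using True by simp
    next
      case False
      then show ?thesis
        using card_pair_le[OF uv False, of i] unfolding pair b_def by simp
    qed
  qed
  also have "\<dots> = T + b * m i * T"
  proof -
    have "(\<Sum>u\<in>low. \<Sum>v\<in>low. b * p v i * cnt u i) = (\<Sum>v\<in>low. \<Sum>u\<in>low. b * p v i * cnt u i)"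
      by (rule sum.swap)
    also have "\<dots> = b * (m i * T)"
      unfolding m_def T_def sum_product by (simp only: sum_distrib_left mult.assoc)
    finally show ?thesis
      using low(3) by (simp add: sum.distrib T_def mult.assoc del: pmf_binomial)
  qed
  finally have SY2: "(\<Sum>G\<in>Gr. (Y G i)\<^sup>2) \<le> T + b * m i * T" .
  have "(\<Sum>G\<in>Gr. (Y G i - m i)\<^sup>2) = (\<Sum>G\<in>Gr. (Y G i)\<^sup>2) - 2 * m i * (\<Sum>G\<in>Gr. Y G i) + N * (m i)\<^sup>2"
    by (simp add: power2_diff sum.distrib sum_subtractf sum_distrib_left N_def mult.commute mult.left_commute)
  also have "\<dots> \<le> T + b * m i * T - 2 * m i * T + N * (m i)\<^sup>2"
    using SY2 by (simp add: SY)
  also have "\<dots> \<le> 2 * m i * N + b * m i * ((1 + 2 * \<kappa>) * m i * N) - 2 * m i * ((1 - \<kappa>) * m i * N) + N * (m i)\<^sup>2"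
  proof -
    have "(1 + 2 * \<kappa>) * (m i * N) \<le> 2 * (m i * N)"
      using kappa_bounds N0 m_nonneg by (intro mult_right_mono) auto
    then have 1: "T \<le> 2 * m i * N" using Tub by (simp add: mult.assoc)
    have 2: "b * m i * T \<le> b * m i * ((1 + 2 * \<kappa>) * m i * N)"
      using Tub b0 m_nonneg by (intro mult_left_mono mult_nonneg_nonneg) auto
    have 3: "2 * m i * ((1 - \<kappa>) * m i * N) \<le> 2 * m i * T"
      using Tlb m_nonneg by (intro mult_left_mono) auto
    show ?thesis using 1 2 3 by linarith
  qed
  also have "\<dots> = N * (2 * m i + (b * (1 + 2 * \<kappa>) - 2 * (1 - \<kappa>) + 1) * (m i)\<^sup>2)"
    by (simp add: algebra_simps power2_eq_square)
  also have "\<dots> \<le> N * (2 * m i + (14 * \<kappa> + \<mu>) * (m i)\<^sup>2)"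
  proof (intro mult_left_mono add_left_mono mult_right_mono N0)
    \<comment> \<open>\<open>b * (1 + 2 * \<kappa>)\<close> is at most
      \<open>1 + 12 * \<kappa> + \<mu>\<close>, and the cross term adds another
      \<open>2 * \<kappa>\<close>.\<close>
    have "\<kappa> * \<kappa> \<le> 1/2 * \<kappa>" using kappa_bounds by (intro mult_right_mono) auto
    then have "(1 + 2 * \<kappa>) * (1 + 2 * \<kappa>) \<le> 1 + 6 * \<kappa>" by (simp add: algebra_simps)
    then have "(1 + 2 * \<kappa>) * (1 + 2 * \<kappa>) * (1 + \<mu>) \<le> (1 + 6 * \<kappa>) * (1 + \<mu>)"
      using mu_bounds by (intro mult_right_mono) auto
    also have "\<dots> = 1 + 6 * \<kappa> + \<mu> + 6 * (\<kappa> * \<mu>)" by (simp add: algebra_simps)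
    also have "\<kappa> * \<mu> \<le> \<kappa> * 1" using mu_bounds kappa_bounds by (intro mult_left_mono) auto
    finally show "b * (1 + 2 * \<kappa>) - 2 * (1 - \<kappa>) + 1 \<le> 14 * \<kappa> + \<mu>"
      by (simp add: b_def mult.commute mult.left_commute)
  qed simp
  finally show ?thesis by (simp add: N_def)
qed

text \<open>Half of the additive error of part (c) is held back for replacing \<open>m i\<close> by
  n_i(d_H).\<close>

definition "thr i = g * m i / C ^ 3 + g * C ^ 5 / 2"

text \<open>Each term of the second moment is matched with a part of the squared threshold
  \<open>(x + y)\<^sup>2\<close>: the linear one with
  \<open>4 * x * y = 2 * m i * (g * C)\<^sup>2\<close> (the arithmetic-geometric mean inequality),
  the quadratic one with \<open>x\<^sup>2\<close> alone.\<close>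

lemma chebyshev_count:
  "real (card {G\<in>Gr. thr i < \<bar>Y G i - m i\<bar>}) \<le> real (card Gr) * (1 / (g * C)\<^sup>2 + (14 * \<kappa> + \<mu>) * C ^ 6 / g\<^sup>2)"
proof -
  define A where "A = {G\<in>Gr. thr i < \<bar>Y G i - m i\<bar>}"
  have tpos: "0 < thr i"
    unfolding thr_def using g_bounds C_pos m_nonneg by (intro add_nonneg_pos) auto
  have "real (card A) * (thr i)\<^sup>2 = (\<Sum>G\<in>A. (thr i)\<^sup>2)"
    by simp
  also have "\<dots> \<le> (\<Sum>G\<in>A. (Y G i - m i)\<^sup>2)"
  proof (intro sum_mono)
    fix G assume "G \<in> A"
    then have "\<bar>thr i\<bar> \<le> \<bar>Y G i - m i\<bar>" using tpos by (simp add: A_def)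
    then show "(thr i)\<^sup>2 \<le> (Y G i - m i)\<^sup>2" by (simp add: abs_le_square_iff)
  qed
  also have "\<dots> \<le> (\<Sum>G\<in>Gr. (Y G i - m i)\<^sup>2)"
    using finite_Gr by (intro sum_mono2) (auto simp: A_def)
  also note second_moment
  also have "real (card Gr) * (2 * m i + (14 * \<kappa> + \<mu>) * (m i)\<^sup>2)
      \<le> real (card Gr) * ((1 / (g * C)\<^sup>2 + (14 * \<kappa> + \<mu>) * C ^ 6 / g\<^sup>2) * (thr i)\<^sup>2)"
  proof (intro mult_left_mono)
    define x where "x = g * m i / C ^ 3"
    define y where "y = g * C ^ 5 / 2"
    have xy: "0 \<le> x" "0 \<le> y" using g_bounds C_pos m_nonneg by (auto simp: x_def y_def)
    have thr: "(thr i)\<^sup>2 = x\<^sup>2 + y\<^sup>2 + 2 * x * y" by (simp add: thr_def x_def y_def power2_sum)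
    have "4 * (x * y) \<le> (thr i)\<^sup>2"
      unfolding thr using zero_le_power2[of "x - y"] by (simp add: power2_diff)
    moreover have "4 * (x * y) = 2 * m i * (g * C)\<^sup>2"
    proof -
      have "C ^ 5 = C ^ 3 * C ^ 2" by (simp flip: power_add)
      then show ?thesis
        using C_pos by (simp add: x_def y_def power2_eq_square)
    qed
    ultimately have 1: "2 * m i \<le> 1 / (g * C)\<^sup>2 * (thr i)\<^sup>2"
      using g_bounds C_pos by (simp add: pos_le_divide_eq)
    have "x\<^sup>2 \<le> (thr i)\<^sup>2" unfolding thr using xy by simp
    moreover have "x\<^sup>2 * (C ^ 6 / g\<^sup>2) = (m i)\<^sup>2"
    proof -
      have "C ^ 6 = C ^ 3 * C ^ 3" by (simp flip: power_add)
      then show ?thesis using C_pos g_bounds by (simp add: x_def power2_eq_square)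
    qed
    ultimately have "(m i)\<^sup>2 \<le> (thr i)\<^sup>2 * (C ^ 6 / g\<^sup>2)"
      using mult_right_mono[of "x\<^sup>2" "(thr i)\<^sup>2" "C ^ 6 / g\<^sup>2"] C_pos by simp
    then have 2: "(14 * \<kappa> + \<mu>) * (m i)\<^sup>2 \<le> (14 * \<kappa> + \<mu>) * ((thr i)\<^sup>2 * (C ^ 6 / g\<^sup>2))"
      using kappa_bounds mu_bounds by (intro mult_left_mono) auto
    show "2 * m i + (14 * \<kappa> + \<mu>) * (m i)\<^sup>2 \<le> (1 / (g * C)\<^sup>2 + (14 * \<kappa> + \<mu>) * C ^ 6 / g\<^sup>2) * (thr i)\<^sup>2"
    proof -
      have "(a + e * b / h) * s = a * s + e * (s * (b / h))" for a e b h s :: real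
        by (simp add: distrib_right)
      then show ?thesis using add_mono[OF 1 2] by simp
    qed
  qed simp
  finally have "real (card A) * (thr i)\<^sup>2 \<le> (real (card Gr) * (1 / (g * C)\<^sup>2 + (14 * \<kappa> + \<mu>) * C ^ 6 / g\<^sup>2)) * (thr i)\<^sup>2"
    by (simp only: mult.assoc)
  then show ?thesis
    using tpos by (simp add: A_def)
qed

end

section \<open>The typical event\<close>

lemma count_list_dS_list:
  assumes "finite S"
  shows "count_list (dS_list G S) i = card {v\<in>S. deg_in G S v = i}"
proof -
  have "count_list (dS_list G S) i = length (filter (\<lambda>v. deg_in G S v = i) (sorted_list_of_set S))"
    by (simp add: dS_list_def count_list_eq_length_filter filter_map o_def eq_commute)
  also have "\<dots> = card (set (filter (\<lambda>v. deg_in G S v = i) (sorted_list_of_set S)))"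
    by (intro distinct_card[symmetric] distinct_filter) simp
  finally show ?thesis using assms by simp
qed

text \<open>A count is a difference of two roundings, each off by at most 1/2; for
  \<open>i = 0\<close> there is just one.\<close>

lemma dH_count_approx:
  assumes "finite S"
  shows "\<bar>real_of_int (dH_count d S g i) - (\<Sum>v\<in>S. pmf (binomial_pmf (d v) g) i)\<bar> \<le> 1"
proof -
  define H where "H k = (\<Sum>v\<in>S. measure_pmf.prob (binomial_pmf (d v) g) {..k})" for k
  have N: "H k - 1/2 < real_of_int (Nfun d S g k)" "real_of_int (Nfun d S g k) \<le> H k + 1/2" for k
    unfolding Nfun_def H_def by linarith+
  show ?thesis
  proof (cases i)
    case 0
    have "{..0 :: nat} = {0}" by auto
    then have "H 0 = (\<Sum>v\<in>S. pmf (binomial_pmf (d v) g) 0)"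
      by (simp add: H_def pmf.rep_eq)
    then show ?thesis using N[of 0] 0 by (simp add: dH_count_def)
  next
    case (Suc k)
    have "measure_pmf.prob P {..Suc k} = measure_pmf.prob P {..k} + pmf P (Suc k)" for P
      by (simp add: atMost_Suc measure_measure_pmf_finite)
    then have "H (Suc k) = H k + (\<Sum>v\<in>S. pmf (binomial_pmf (d v) g) (Suc k))"
      by (simp only: H_def sum.distrib)
    then show ?thesis using N[of k] N[of "Suc k"] Suc by (simp add: dH_count_def)
  qed
qed

context degree_setup
begin

definition good :: "nat set set \<Rightarrow> bool" where
  "good G \<longleftrightarrow>
     (let s = card S; is = sorted_list_of_set S; dS = dS_list G S; dH = dH_entry d S g in
        (\<forall>k\<in>{1..s}. t ^ 2 * C \<le> real (d (is ! (k - 1))) \<longrightarrow>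
            \<bar>real (dS ! (k - 1)) - g * real (d (is ! (k - 1)))\<bar> \<le> 8 * t * (g * real (d (is ! (k - 1))))
          \<and> \<bar>real (dS ! (k - 1)) - real (dH k)\<bar> \<le> 12 * t * real (dH k))
      \<and> (\<forall>k\<in>{1..s}. real (d (is ! (k - 1))) < t ^ 2 * C \<longrightarrow>
            real (max (dS ! (k - 1)) (dH k)) \<le> 2 * g * t ^ 2 * C)
      \<and> (\<forall>i::nat. real i \<le> g * C / 2 \<longrightarrow>
            \<bar>real (count_list dS i) - real_of_int (dH_count d S g i)\<bar>
              \<le> g * real_of_int (dH_count d S g i) / C ^ 3 + g * C ^ 5))"

lemma nth_dS_list: "k \<in> {1..card S} \<Longrightarrow> dS_list G S ! (k - 1) = deg_in G S (vtx k)"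
  unfolding dS_list_def by (intro nth_map) auto

text \<open>The first two sets serve part (a), the third part (b); the fourth keeps vertices of
  degree above \<open>C\<close> out of the counts in part (c). The conditions on \<open>d v\<close>
  stand inside the sets so that one union bound treats all vertices alike. The multiple 7/4 of
  \<open>t\<close> meets two demands: its square 49/16 exceeds 3, and the deviation
  \<open>7/2 * t\<close> stays within the constants 8 and 12 of part (a).\<close>

definition atypical :: "nat \<Rightarrow> nat set set set" where
  "atypical v =
     {G\<in>Gr. t ^ 2 * C \<le> real (d v) \<and> (1 + 2 * (7/4 * t)) * g * real (d v) < real (deg_in G S v)} \<union>
     {G\<in>Gr. t ^ 2 * C \<le> real (d v) \<and> real (deg_in G S v) < (1 - 2 * (7/4 * t)) * g * real (d v)} \<union>
     {G\<in>Gr. real (d v) < t ^ 2 * C \<and> (1 + 2 * (1/4)) * g * (t ^ 2 * C) < real (deg_in G S v)} \<union>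
     {G\<in>Gr. C < real (d v) \<and> real (deg_in G S v) < (1 - 2 * (1/4)) * g * real (d v)}"

lemma gt2C: "g * (t ^ 2 * C) = L / t ^ 2"
proof -
  have t4: "t ^ 4 = t ^ 2 * t ^ 2" by (simp flip: power_add)
  have "g * (x * (L / (x * x * g))) = L / x" if "x > 0" for x
    using g_bounds that by simp
  from this[of "t ^ 2"] show ?thesis unfolding C t4 using t by (simp only: zero_less_power)
qed

lemma inverse_t_power: "48 * L \<le> L / t ^ 2"
proof -
  have "t ^ 2 \<le> (1/1000) ^ 2" using t by (intro power_mono) auto
  then have "t ^ 2 \<le> 1/48" by (simp add: power2_eq_square)
  then have "48 * L * t ^ 2 \<le> L" using L8 by (simp add: field_simps)
  then show ?thesis
    using t by (simp add: pos_le_divide_eq)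
qed

text \<open>From \<open>t\<^sup>2 * C\<close> on, the binomial mean is at least
  \<open>L / t ^ 2\<close>. The factor \<open>(7/4 * t)\<^sup>2\<close> reduces this to
  \<open>49/16 * L\<close>; for 1/4 it suffices that the mean is at least
  \<open>48 * L\<close>.\<close>

lemma large_mean:
  "t ^ 2 * C \<le> R \<Longrightarrow> 3 * L \<le> (7/4 * t)\<^sup>2 * g * R"
  "t ^ 2 * C \<le> R \<Longrightarrow> 3 * L \<le> (1/4)\<^sup>2 * g * R"
proof -
  assume R: "t ^ 2 * C \<le> R"
  then have le: "L / t ^ 2 \<le> g * R"
    unfolding gt2C[symmetric] using g_bounds by (intro mult_left_mono) auto
  have "3 * L \<le> 49/16 * t ^ 2 * (L / t ^ 2)"
    using t L8 by simp
  also have "\<dots> \<le> 49/16 * t ^ 2 * (g * R)"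
    using le by (intro mult_left_mono) auto
  finally show "3 * L \<le> (7/4 * t)\<^sup>2 * g * R"
    by (simp add: power2_eq_square)
  show "3 * L \<le> (1/4)\<^sup>2 * g * R"
    using le inverse_t_power by (simp add: power2_eq_square)
qed

lemma C_large: "t ^ 2 * C \<le> C"
  using t C_pos by (simp add: power_le_one)

lemma eta_bounds: "0 < 7/4 * t" "7/4 * t \<le> 1/4" "\<epsilon> \<le> 7/4 * t / 16" "\<epsilon> \<le> 1/4/16"
  using t eps_small by auto

lemma card_atypical:
  assumes v: "v \<in> S"
  shows "real (card (atypical v)) \<le> 4 * \<tau> * real (card Gr)"
proof -
  have b: "0 \<le> \<tau> * real (card Gr)" by (simp add: \<tau>_def)
  have cond: "real (card {G\<in>Gr. Q \<and> P G}) \<le> \<tau> * real (card Gr)"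
    if "Q \<Longrightarrow> real (card {G\<in>Gr. P G}) \<le> \<tau> * real (card Gr)" for P Q
    using that b by (cases Q) auto
  note ta = graph_tails[OF v eta_bounds(1,2,3)]
  note tb = graph_tails[OF v _ _ eta_bounds(4)]
  have 1: "real (card {G\<in>Gr. t ^ 2 * C \<le> real (d v) \<and> (1 + 2 * (7/4 * t)) * g * real (d v) < real (deg_in G S v)}) \<le> \<tau> * real (card Gr)"
    by (intro cond ta(1) large_mean order_refl)
  have 2: "real (card {G\<in>Gr. t ^ 2 * C \<le> real (d v) \<and> real (deg_in G S v) < (1 - 2 * (7/4 * t)) * g * real (d v)}) \<le> \<tau> * real (card Gr)"
    by (intro cond ta(2) large_mean)
  have 3: "real (card {G\<in>Gr. real (d v) < t ^ 2 * C \<and> (1 + 2 * (1/4)) * g * (t ^ 2 * C) < real (deg_in G S v)}) \<le> \<tau> * real (card Gr)"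
    by (intro cond tb(1) large_mean) auto
  have 4: "real (card {G\<in>Gr. C < real (d v) \<and> real (deg_in G S v) < (1 - 2 * (1/4)) * g * real (d v)}) \<le> \<tau> * real (card Gr)"
    using C_large by (intro cond tb(2) large_mean) auto
  have "real (card (A1 \<union> A2 \<union> A3 \<union> A4)) \<le> 4 * x"
    if "real (card A1) \<le> x" "real (card A2) \<le> x" "real (card A3) \<le> x" "real (card A4) \<le> x"
    for A1 A2 A3 A4 :: "nat set set set" and x
    using that card_Un_le[of "A1 \<union> A2 \<union> A3" A4] card_Un_le[of "A1 \<union> A2" A3] card_Un_le[of A1 A2] by linarith
  from this[OF 1 2 3 4] show ?thesis
    unfolding atypical_def by (simp only: mult.assoc)
qed

text \<open>With \<open>C < d v\<close>, values up to \<open>g * C / 2\<close> lie below half of the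
  binomial mean.\<close>

lemma p_high_le:
  assumes "v \<in> S" "v \<notin> low" "real i \<le> g * C / 2"
  shows "p v i \<le> \<tau>"
proof -
  have v: "C < real (d v)" using assms by (auto simp: low_def)
  have "p v i = measure_pmf.prob (binomial_pmf (d v) g) {i}"
    by (simp only: pmf.rep_eq)
  also have "\<dots> \<le> measure_pmf.prob (binomial_pmf (d v) g) {..i}"
    by (intro measure_pmf.finite_measure_mono) auto
  also have "\<dots> \<le> \<tau>"
  proof (rule binomial_tails(2)[OF assms(1), of "1/4"])
    show "3 * L \<le> (1/4)\<^sup>2 * g * real (d v)" using v C_large by (intro large_mean) auto
    have "g * C < g * real (d v)" using v g_bounds by simp
    then show "real i < (1 - 2 * (1/4)) * g * real (d v)" using assms(3) by simp
  qed auto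
  finally show ?thesis .
qed

lemma m_approx:
  assumes "real i \<le> g * C / 2"
  shows "m i \<le> (\<Sum>v\<in>S. p v i)" "(\<Sum>v\<in>S. p v i) \<le> m i + 1"
proof -
  have "low \<subseteq> S" using low(1) by blast
  then have eq: "(\<Sum>v\<in>S. p v i) = (\<Sum>v\<in>S - low. p v i) + m i"
    unfolding m_def using finS by (intro sum.subset_diff)
  have "0 \<le> (\<Sum>v\<in>S - low. p v i)" by (intro sum_nonneg pmf_nonneg)
  then show "m i \<le> (\<Sum>v\<in>S. p v i)" using eq by simp
  have "(\<Sum>v\<in>S - low. p v i) \<le> real (card (S - low)) * \<tau>"
    using p_high_le assms by (intro sum_bounded_above) auto
  also have "\<dots> \<le> real (card S) * \<tau>"
    using finS by (intro mult_right_mono) (auto simp: \<tau>_def intro: card_mono)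
  finally show "(\<Sum>v\<in>S. p v i) \<le> m i + 1" using card_S_tau eq by simp
qed

lemma good_if_typical:
  assumes G: "G \<in> Gr" and typical: "\<And>v. v \<in> S \<Longrightarrow> G \<notin> atypical v"
    and cheb: "\<And>i. real i \<le> g * C / 2 \<Longrightarrow> \<bar>Y G i - m i\<bar> \<le> thr i"
  shows "good G"
  unfolding good_def Let_def
proof (intro conjI ballI allI impI)
  fix k assume k: "k \<in> {1..card S}" and big: "t ^ 2 * C \<le> real (d (vtx k))"
  define v where "v = vtx k"
  have v: "v \<in> S" using vtx_in_S[OF k] by (simp add: v_def)
  define R where "R = g * real (d v)"
  have R0: "0 \<le> R" using g_bounds by (simp add: R_def)
  have "\<not> (1 + 2 * (7/4 * t)) * g * real (d v) < real (deg_in G S v)" "\<not> real (deg_in G S v) < (1 - 2 * (7/4 * t)) * g * real (d v)"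
    using typical[OF v] G big by (auto simp: atypical_def v_def)
  then have 1: "real (deg_in G S v) \<le> R + 7/2 * (t * R)" "R - 7/2 * (t * R) \<le> real (deg_in G S v)"
    by (simp_all add: R_def algebra_simps)
  have 2: "real (dH_entry d S g k) \<le> R + 7/2 * (t * R)" "R - 7/2 * (t * R) \<le> real (dH_entry d S g k)"
    using dH_upper(1)[OF k eta_bounds(1,2) order_refl large_mean(1)[OF big]]
      dH_lower[OF k eta_bounds(1,2) large_mean(1)[OF big]]
    by (simp_all add: R_def v_def algebra_simps)
  have tR: "0 \<le> t * R" using t R0 by simp
  show "\<bar>real (dS_list G S ! (k - 1)) - g * real (d (vtx k))\<bar> \<le> 8 * t * (g * real (d (vtx k)))"
    using 1 tR unfolding nth_dS_list[OF k] R_def v_def by (simp add: abs_le_iff)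
  have "t * R \<le> 1/1000 * R" using t R0 by (intro mult_right_mono) auto
  \<comment> \<open>d_S(k) and d_H(k) both lie within \<open>7/2 * t * R\<close> of
    \<open>R\<close>, hence within \<open>7 * t * R\<close> of each other. The constant 7/12 turns
    this into \<open>12 * t\<close> times d_H(k).\<close>
  then have "7/12 * R \<le> real (dH_entry d S g k)" using 2 R0 by linarith
  then have "12 * t * (7/12 * R) \<le> 12 * t * real (dH_entry d S g k)"
    using t by (intro mult_left_mono) auto
  moreover have "12 * t * (7/12 * R) = 7 * (t * R)" by simp
  ultimately show "\<bar>real (dS_list G S ! (k - 1)) - real (dH_entry d S g k)\<bar> \<le> 12 * t * real (dH_entry d S g k)"
    using 1 2 unfolding nth_dS_list[OF k] v_def[symmetric] by linarith
next
  fix k assume k: "k \<in> {1..card S}" and small: "real (d (vtx k)) < t ^ 2 * C"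
  define v where "v = vtx k"
  have v: "v \<in> S" using vtx_in_S[OF k] by (simp add: v_def)
  have pos: "0 \<le> g * (t ^ 2 * C)" using g_bounds C_pos by simp
  have "real (deg_in G S v) \<le> (1 + 2 * (1/4)) * g * (t ^ 2 * C)"
    using typical[OF v] G small by (auto simp: atypical_def v_def)
  moreover have "real (dH_entry d S g k) \<le> (1 + 2 * (1/4)) * g * (t ^ 2 * C)"
    using small by (intro dH_upper(1)[OF k] large_mean) auto
  ultimately show "real (max (dS_list G S ! (k - 1)) (dH_entry d S g k)) \<le> 2 * g * t ^ 2 * C"
    unfolding nth_dS_list[OF k] using pos by (simp add: v_def max_def)
next
  fix i :: nat assume i: "real i \<le> g * C / 2"
  define h where "h = real_of_int (dH_count d S g i)"
  \<comment> \<open>A vertex outside \<open>low\<close> has induced degree at least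
    \<open>g * d v / 2\<close>, which exceeds \<open>g * C / 2\<close> and hence
    \<open>i\<close>.\<close>
  have "{v\<in>S. deg_in G S v = i} = {v\<in>low. deg_in G S v = i}"
  proof -
    have "deg_in G S v \<noteq> i" if v: "v \<in> S" "v \<notin> low" for v
    proof
      assume eq: "deg_in G S v = i"
      have Cv: "C < real (d v)" using v by (auto simp: low_def)
      have "\<not> real (deg_in G S v) < (1 - 2 * (1/4)) * g * real (d v)"
        using typical[OF v(1)] G Cv by (auto simp: atypical_def)
      moreover have "g * C < g * real (d v)" using Cv g_bounds by simp
      ultimately show False using i eq by simp
    qed
    then show ?thesis using low(1) by blast
  qed
  then have cY: "real (count_list (dS_list G S) i) = Y G i"
    by (simp add: count_list_dS_list[OF finS] Y_def)
  have h: "\<bar>h - (\<Sum>v\<in>S. p v i)\<bar> \<le> 1"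
    unfolding h_def by (rule dH_count_approx[OF finS])
  note ma = m_approx[OF i]
  have gC3: "0 \<le> g / C ^ 3" "g / C ^ 3 \<le> 1"
  proof -
    show "0 \<le> g / C ^ 3" using g_bounds C_pos by simp
    have "1 \<le> C ^ 3" using C_ge by (intro one_le_power) auto
    then show "g / C ^ 3 \<le> 1" using g_bounds C_pos by (simp add: pos_divide_le_eq)
  qed
  have "m i \<le> h + 1" using ma h by linarith
  then have "g / C ^ 3 * m i \<le> g / C ^ 3 * (h + 1)" using gC3 by (intro mult_left_mono) auto
  also have "\<dots> \<le> g / C ^ 3 * h + 1" using gC3 by (simp add: distrib_left)
  finally have 1: "g / C ^ 3 * m i \<le> g / C ^ 3 * h + 1" .
  have "L * 1 \<le> (g * C) * C ^ 4"
    using gC_ge C_ge L8 by (intro mult_mono one_le_power) auto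
  moreover have "(g * C) * C ^ 4 = g * C ^ 5" by (simp add: power_numeral_reduce)
  \<comment> \<open>The reserved \<open>g * C ^ 5 / 2\<close> is at least 4. It has to cover 3: at
    most 2 for the distance of \<open>m i\<close> from \<open>h\<close>, and 1 for replacing
    \<open>m i\<close> by \<open>h\<close> in the relative term.\<close>
  ultimately have 2: "8 \<le> g * C ^ 5" using L8 by linarith
  have "\<bar>Y G i - m i\<bar> \<le> g / C ^ 3 * m i + g * C ^ 5 / 2"
    using cheb[OF i] by (simp add: thr_def)
  then have "\<bar>Y G i - h\<bar> \<le> g / C ^ 3 * h + g * C ^ 5"
    using 1 2 h ma by linarith
  then show "\<bar>real (count_list (dS_list G S) i) - real_of_int (dH_count d S g i)\<bar>
          \<le> g * real_of_int (dH_count d S g i) / C ^ 3 + g * C ^ 5"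
    unfolding cY h_def by simp
qed

text \<open>The constant is 4 + 3. The four tail events per vertex cost
  \<open>4 * exp (- (L / 2))\<close> in total and the Chebyshev bounds over all \<open>i\<close>
  cost \<open>1 / L + 2 / L\<close>; both \<open>exp (- (L / 2))\<close> and \<open>1 / L\<close>
  are at most \<open>1 / sqrt L\<close>.\<close>

lemma card_not_good:
  "real (card {G\<in>Gr. \<not> good G}) \<le> 7 / sqrt L * real (card Gr)"
proof -
  define I where "I = {i::nat. real i \<le> g * C / 2}"
  define N where "N = real (card Gr)"
  define e where "e = 1 / (g * C)\<^sup>2 + (14 * \<kappa> + \<mu>) * C ^ 6 / g\<^sup>2"
  have e0: "0 \<le> e" using kappa_bounds mu_bounds C_pos by (simp add: e_def)
  have N0: "0 \<le> N" by (simp add: N_def)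
  have gC8: "8 \<le> g * C" using gC_ge L8 by linarith
  have I: "I \<subseteq> {..nat \<lfloor>g * C / 2\<rfloor>}"
    unfolding I_def by (auto simp: le_nat_iff le_floor_iff)
  then have finI: "finite I" by (rule finite_subset) simp
  have "card I \<le> nat \<lfloor>g * C / 2\<rfloor> + 1"
    using card_mono[OF _ I] by simp
  then have cI: "real (card I) \<le> g * C" using gC8 by linarith
  have cA: "real (card (\<Union>v\<in>S. atypical v)) \<le> 4 * exp (- (L / 2)) * N"
  proof -
    have "real (card (\<Union>v\<in>S. atypical v)) \<le> (\<Sum>v\<in>S. real (card (atypical v)))"
      using card_UN_le[OF finS, of atypical] by (simp flip: of_nat_sum)
    also have "\<dots> \<le> real (card S) * (4 * \<tau> * N)"
      unfolding N_def by (intro sum_bounded_above card_atypical)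
    also have "\<dots> = 4 * (real (card S) * \<tau>) * N" by simp
    also have "\<dots> \<le> 4 * exp (- (L / 2)) * N"
      using card_S_tau(1) N0 by (intro mult_right_mono) auto
    finally show ?thesis .
  qed
  have cB: "real (card (\<Union>i\<in>I. {G\<in>Gr. thr i < \<bar>Y G i - m i\<bar>})) \<le> 3 / L * N"
  proof -
    have "real (card (\<Union>i\<in>I. {G\<in>Gr. thr i < \<bar>Y G i - m i\<bar>})) \<le> (\<Sum>i\<in>I. real (card {G\<in>Gr. thr i < \<bar>Y G i - m i\<bar>}))"
      using card_UN_le[OF finI, of "\<lambda>i. {G\<in>Gr. thr i < \<bar>Y G i - m i\<bar>}"] by (simp flip: of_nat_sum)
    also have "\<dots> \<le> real (card I) * (N * e)"
      unfolding N_def e_def by (intro sum_bounded_above chebyshev_count)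
    also have "\<dots> \<le> g * C * (N * e)"
      using cI N0 e0 by (intro mult_right_mono) auto
    also have "\<dots> = (1 / (g * C) + (14 * \<kappa> + \<mu>) * C ^ 7 / g) * N"
    proof -
      have "C ^ 7 = C ^ 6 * C" by (simp flip: power_Suc2)
      then have "g * C * ((14 * \<kappa> + \<mu>) * C ^ 6 / g\<^sup>2) = (14 * \<kappa> + \<mu>) * C ^ 7 / g"
        using g_bounds by (simp add: power2_eq_square)
      moreover have "g * C * (1 / (g * C)\<^sup>2) = 1 / (g * C)"
        using gC8 by (simp add: power2_eq_square)
      ultimately have "g * C * e = 1 / (g * C) + (14 * \<kappa> + \<mu>) * C ^ 7 / g"
        unfolding e_def distrib_left by simp
      then show ?thesis by (metis mult.assoc mult.commute)
    qed
    also have "\<dots> \<le> (1 / L + 2 / L) * N"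
    proof (intro mult_right_mono add_mono error_le N0)
      show "1 / (g * C) \<le> 1 / L" using gC_ge L8 by (intro divide_left_mono) auto
    qed
    finally show ?thesis by simp
  qed
  have "{G\<in>Gr. \<not> good G} \<subseteq> (\<Union>v\<in>S. atypical v) \<union> (\<Union>i\<in>I. {G\<in>Gr. thr i < \<bar>Y G i - m i\<bar>})"
  proof
    fix G assume G: "G \<in> {G\<in>Gr. \<not> good G}"
    show "G \<in> (\<Union>v\<in>S. atypical v) \<union> (\<Union>i\<in>I. {G\<in>Gr. thr i < \<bar>Y G i - m i\<bar>})"
    proof (rule ccontr)
      assume n: "\<not> ?thesis"
      have "good G"
        using G n by (intro good_if_typical) (auto simp: I_def not_less)
      then show False using G by simp
    qed
  qed
  moreover have "finite ((\<Union>v\<in>S. atypical v) \<union> (\<Union>i\<in>I. {G\<in>Gr. thr i < \<bar>Y G i - m i\<bar>}))"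
    using finS finI finite_Gr by (auto simp: atypical_def)
  ultimately have "card {G\<in>Gr. \<not> good G} \<le> card ((\<Union>v\<in>S. atypical v) \<union> (\<Union>i\<in>I. {G\<in>Gr. thr i < \<bar>Y G i - m i\<bar>}))"
    by (rule card_mono[rotated])
  also have "\<dots> \<le> card (\<Union>v\<in>S. atypical v) + card (\<Union>i\<in>I. {G\<in>Gr. thr i < \<bar>Y G i - m i\<bar>})"
    by (rule card_Un_le)
  finally have "real (card {G\<in>Gr. \<not> good G}) \<le> 4 * exp (- (L / 2)) * N + 3 / L * N"
    using cA cB by linarith
  also have "\<dots> \<le> 4 * (1 / sqrt L) * N + 3 * (1 / sqrt L) * N"
  proof -
    have sq: "sqrt L * sqrt L = L" "1 \<le> sqrt L" using L8 by simp_all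
    have "sqrt L \<le> 1 + L / 2"
    proof -
      have "0 \<le> (sqrt L - 1) * (sqrt L - 1)" by simp
      also have "\<dots> = sqrt L * sqrt L - 2 * sqrt L + 1" by (simp only: algebra_simps)
      finally show ?thesis unfolding sq(1) by linarith
    qed
    also have "\<dots> \<le> exp (L / 2)" by (rule exp_ge_add_one_self)
    finally have 1: "exp (- (L / 2)) \<le> 1 / sqrt L"
      using L8 by (simp add: exp_minus field_simps)
    have "sqrt L * 1 \<le> sqrt L * sqrt L" using sq(2) by (intro mult_left_mono) auto
    then have "1 / L \<le> 1 / sqrt L" using L8 sq(1) by (intro divide_left_mono) auto
    then have 2: "3 / L \<le> 3 * (1 / sqrt L)" by simp
    show ?thesis using 1 2 N0 by (intro add_mono mult_right_mono) auto
  qed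
  also have "\<dots> = 7 / sqrt L * N" by (simp add: algebra_simps)
  finally show ?thesis by (simp add: N_def)
qed

lemma prob_good:
  "0 \<le> 1 - measure_pmf.prob (pmf_of_set Gr) {G. good G}"
  "1 - measure_pmf.prob (pmf_of_set Gr) {G. good G} \<le> 7 / sqrt L"
proof -
  show "0 \<le> 1 - measure_pmf.prob (pmf_of_set Gr) {G. good G}" by simp
  have "measure_pmf.prob (pmf_of_set Gr) (UNIV - {G. good G}) = real (card (Gr \<inter> (UNIV - {G. good G}))) / real (card Gr)"
    using card_Gr_pos finite_Gr by (intro measure_pmf_of_set) auto
  also have "Gr \<inter> (UNIV - {G. good G}) = {G\<in>Gr. \<not> good G}" by auto
  finally have "1 - measure_pmf.prob (pmf_of_set Gr) {G. good G} = real (card {G\<in>Gr. \<not> good G}) / real (card Gr)"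
    using measure_pmf.prob_compl[of "{G. good G}" "pmf_of_set Gr"] by simp
  then show "1 - measure_pmf.prob (pmf_of_set Gr) {G. good G} \<le> 7 / sqrt L"
    using card_not_good card_Gr_pos by (simp add: pos_divide_le_eq)
qed

end

section \<open>Passage from a fixed number of vertices to the asymptotic statement\<close>

theorem theorem2p3:
  fixes d :: "nat \<Rightarrow> nat \<Rightarrow> nat" and S :: "nat \<Rightarrow> nat set"
    and \<delta> :: "nat \<Rightarrow> real" and c :: real
  defines "M \<equiv> \<lambda>n. \<Sum>i=1..n. d n i"
    and "\<Delta> \<equiv> \<lambda>n. d n n"
    and "\<gamma> \<equiv> \<lambda>n. real (\<Sum>i\<in>S n. d n i) / real (\<Sum>i=1..n. d n i)"
    and "C \<equiv> \<lambda>n. \<delta> n powr (-1/16) * (real (\<Sum>i=1..n. d n i) / real (\<Sum>i\<in>S n. d n i))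
                   * ln (real (\<Sum>i=1..n. d n i))"
  assumes deg_pos: "\<forall>\<^sub>F n in sequentially. \<forall>i\<in>{1..n}. 1 \<le> d n i"
    and deg_mono: "\<forall>\<^sub>F n in sequentially. \<forall>i\<in>{1..n}. \<forall>j\<in>{1..n}. i \<le> j \<longrightarrow> d n i \<le> d n j"
    and even_sum: "\<forall>\<^sub>F n in sequentially. even (M n)"
    and realizable: "\<forall>\<^sub>F n in sequentially. graphs_with_degrees n (d n) \<noteq> {}"
    and S_sub: "\<forall>\<^sub>F n in sequentially. S n \<subseteq> {1..n}"
    and gamma_pos: "\<forall>\<^sub>F n in sequentially. \<gamma> n > 0"
    and delta_pos: "\<forall>\<^sub>F n in sequentially. \<delta> n > 0"
    and delta_lim: "\<delta> \<longlonglongrightarrow> 0"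
    and delta_inv: "(\<lambda>n. 1 / \<delta> n) \<in> O(\<lambda>n. ln (ln (real (M n))))"
    and main_cond: "\<forall>\<^sub>F n in sequentially.
        real (\<Delta> n) ^ 2 * (ln (real (M n)) / \<gamma> n) ^ 12 \<le> \<delta> n * real (\<Sum>i\<in>S n. d n i)"
    and c_pos: "c > 0"
    and gamma_bound: "\<forall>\<^sub>F n in sequentially. \<gamma> n < 1 - c"
  shows "(\<lambda>n. 1 - measure_pmf.prob (pmf_of_set (graphs_with_degrees n (d n)))
      {G. let s = card (S n); is = sorted_list_of_set (S n); dS = dS_list G (S n);
              dH = dH_entry (d n) (S n) (\<gamma> n) in
        (\<forall>k\<in>{1..s}. \<delta> n powr (1/32) * C n \<le> real (d n (is ! (k - 1))) \<longrightarrow>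
            \<bar>real (dS ! (k - 1)) - \<gamma> n * real (d n (is ! (k - 1)))\<bar>
              \<le> 8 * \<delta> n powr (1/64) * (\<gamma> n * real (d n (is ! (k - 1))))
          \<and> \<bar>real (dS ! (k - 1)) - real (dH k)\<bar> \<le> 12 * \<delta> n powr (1/64) * real (dH k))
      \<and> (\<forall>k\<in>{1..s}. real (d n (is ! (k - 1))) < \<delta> n powr (1/32) * C n \<longrightarrow>
            real (max (dS ! (k - 1)) (dH k)) \<le> 2 * \<gamma> n * \<delta> n powr (1/32) * C n)
      \<and> (\<forall>i::nat. real i \<le> \<gamma> n * C n / 2 \<longrightarrow>
            \<bar>real (count_list dS i) - real_of_int (dH_count (d n) (S n) (\<gamma> n) i)\<bar>
              \<le> \<gamma> n * real_of_int (dH_count (d n) (S n) (\<gamma> n) i) / C n ^ 3 + \<gamma> n * C n ^ 5)})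
    \<in> O(\<lambda>n. 1 / sqrt (ln (real (M n))))"
proof -
  define t where "t n = \<delta> n powr (1/64)" for n
  have DSM: "\<gamma> n = real (\<Sum>i\<in>S n. d n i) / real (M n)" for n
    by (simp add: \<gamma>_def M_def)
  \<comment> \<open>Positive degrees force M to tend to infinity with \<open>n\<close>, so every
    fixed lower bound on \<open>ln M\<close> holds eventually.\<close>
  have M_ge: "\<forall>\<^sub>F n in sequentially. real n \<le> real (M n)"
    using deg_pos
  proof eventually_elim
    case (elim n)
    then have "(\<Sum>i=1..n. 1) \<le> M n" unfolding M_def by (intro sum_mono) auto
    then show ?case by simp
  qed
  have "filterlim (\<lambda>n. real (M n)) at_top sequentially"
    using filterlim_real_sequentially M_ge by (rule filterlim_at_top_mono)
  then have "filterlim (\<lambda>n. ln (real (M n))) at_top sequentially"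
    by (rule filterlim_compose[OF ln_at_top])
  then have L8: "\<forall>\<^sub>F n in sequentially. 8 \<le> ln (real (M n))"
    by (simp add: filterlim_at_top)
  have "t \<longlonglongrightarrow> 0"
    unfolding t_def using delta_lim by (intro tendsto_zero_powrI[of _ _ _ "1/64"]) (auto intro: eventually_mono[OF delta_pos])
  then have t_small: "\<forall>\<^sub>F n in sequentially. t n < min (1/1000) (c / 100)"
    using c_pos by (intro order_tendstoD(2)[of t 0]) auto
  have main: "\<forall>\<^sub>F n in sequentially. norm (1 - measure_pmf.prob (pmf_of_set (graphs_with_degrees n (d n)))
      {G. let s = card (S n); is = sorted_list_of_set (S n); dS = dS_list G (S n);
              dH = dH_entry (d n) (S n) (\<gamma> n) in
        (\<forall>k\<in>{1..s}. \<delta> n powr (1/32) * C n \<le> real (d n (is ! (k - 1))) \<longrightarrow>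
            \<bar>real (dS ! (k - 1)) - \<gamma> n * real (d n (is ! (k - 1)))\<bar>
              \<le> 8 * \<delta> n powr (1/64) * (\<gamma> n * real (d n (is ! (k - 1))))
          \<and> \<bar>real (dS ! (k - 1)) - real (dH k)\<bar> \<le> 12 * \<delta> n powr (1/64) * real (dH k))
      \<and> (\<forall>k\<in>{1..s}. real (d n (is ! (k - 1))) < \<delta> n powr (1/32) * C n \<longrightarrow>
            real (max (dS ! (k - 1)) (dH k)) \<le> 2 * \<gamma> n * \<delta> n powr (1/32) * C n)
      \<and> (\<forall>i::nat. real i \<le> \<gamma> n * C n / 2 \<longrightarrow>
            \<bar>real (count_list dS i) - real_of_int (dH_count (d n) (S n) (\<gamma> n) i)\<bar>
              \<le> \<gamma> n * real_of_int (dH_count (d n) (S n) (\<gamma> n) i) / C n ^ 3 + \<gamma> n * C n ^ 5)})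
      \<le> 7 * norm (1 / sqrt (ln (real (M n))))"
    using deg_pos deg_mono realizable S_sub gamma_pos delta_pos main_cond gamma_bound L8 t_small
  proof eventually_elim
    case (elim n)
    have tpos: "0 < t n" using elim by (simp add: t_def)
    have powers: "\<delta> n = t n ^ 64" "\<delta> n powr (1/32) = t n ^ 2" "\<delta> n powr (-1/16) = 1 / t n ^ 4"
      using elim(6) by (simp_all add: t_def powr_power powr_minus_divide)
    have Mpos: "0 < real (M n)"
      \<comment> \<open>In HOL \<open>ln 0 = 0\<close>, so \<open>8 \<le> ln M\<close> excludes
        \<open>M n = 0\<close>.\<close>
      using elim(9) by (cases "M n = 0") auto
    have DSpos: "0 < real (\<Sum>i\<in>S n. d n i)"
      using elim(5) Mpos by (simp add: DSM zero_less_divide_iff del: of_nat_sum)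
    have C: "C n = ln (real (M n)) / (t n ^ 4 * \<gamma> n)"
      unfolding C_def powers(3) DSM M_def by simp
    interpret degree_setup n "d n" "S n" "\<Delta> n" c "t n" "real (M n)" "real (\<Sum>i\<in>S n. d n i)" "\<gamma> n" "ln (real (M n))" "C n"
    proof
      show "d n i \<le> \<Delta> n" if "i \<in> {1..n}" for i
        using elim(2) that unfolding \<Delta>_def by auto
      show "real (\<Delta> n) ^ 2 * (ln (real (M n)) / \<gamma> n) ^ 12 \<le> t n ^ 64 * real (\<Sum>i\<in>S n. d n i)"
        using elim(7) unfolding powers(1) .
    qed (use elim tpos DSpos C c_pos in \<open>auto simp: DSM M_def \<close>)
    have "norm (1 / sqrt (ln (real (M n)))) = 1 / sqrt (ln (real (M n)))"
      using elim(9) by simp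
    then show ?case
      using prob_good unfolding good_def Gr_def powers(2) t_def[symmetric] by simp
  qed
  show ?thesis
    by (rule bigoI[OF main])
qed

end
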